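(* Let $G$ be a finite group or a compact Lie group, let $\{U(g): g\in G\}$ be a unitary representation of $G$ on a Hilbert space $\mathcal{H}$, and let $|\psi\rangle,|\phi\rangle\in\mathcal{H}$ be unit vectors. The following statements are equivalent: (A) There exists a $G$-invariant unitary $V_{G\text{-inv}}$ on $\mathcal{H}$ such that $V_{G\text{-inv}}|\psi\rangle=|\phi\rangle$. (B) There exists a unitary $V$ on $\mathcal{H}$ such that $VU(g)|\psi\rangle=U(g)|\phi\rangle$ for all $g\in G$.
   Context: Unitary representations of compact Lie groups are (strongly) continuous; such a representation decomposes into a discrete set of finite-dimensional irreducible representations. A unitary $V$ on $\mathcal{H}$ is called $G$-invariant if $[V,U(g)]=0$ for all $g\in G$. *)

theory Defs
  imports "HOL-Analysis.Analysis" "HOL-Algebra.Group"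
begin

section \<open>Complex Hilbert spaces\<close>

text \<open>
  Completeness and the norm topology are inherited from \<^class>\<open>banach\<close>. The inner product is
  conjugate-linear in its first argument. The axiom \<open>cinner_self\<close> says that the norm is the one
  induced by the inner product; together with the norm axioms it contains positive definiteness.
\<close>

class chilbert_space = banach +
  fixes scaleC :: "complex \<Rightarrow> 'a \<Rightarrow> 'a"  (infixr \<open>*\<^sub>C\<close> 75)
    and cinner :: "'a \<Rightarrow> 'a \<Rightarrow> complex"
  assumes scaleC_add_right: "a *\<^sub>C (x + y) = a *\<^sub>C x + a *\<^sub>C y"
    and scaleC_add_left: "(a + b) *\<^sub>C x = a *\<^sub>C x + b *\<^sub>C x"
    and scaleC_scaleC: "a *\<^sub>C (b *\<^sub>C x) = (a * b) *\<^sub>C x"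
    and scaleC_of_real: "complex_of_real r *\<^sub>C x = r *\<^sub>R x"
    and cinner_commute: "cinner x y = cnj (cinner y x)"
    and cinner_add_right: "cinner x (y + z) = cinner x y + cinner x z"
    and cinner_scaleC_right: "cinner x (a *\<^sub>C y) = a * cinner x y"
    and cinner_self: "cinner x x = complex_of_real ((norm x)\<^sup>2)"

definition unitary :: "('h::chilbert_space \<Rightarrow> 'h) \<Rightarrow> bool" where
  "unitary V \<longleftrightarrow>
     Vector_Spaces.linear scaleC scaleC V \<and> surj V \<and> (\<forall>x y. cinner (V x) (V y) = cinner x y)"


section \<open>Smooth maps between open subsets of Euclidean spaces\<close>

text \<open>Both notions are meant for open \<open>S\<close> only.\<close>

primrec Ck_on :: "nat \<Rightarrow> 'a::euclidean_space set \<Rightarrow> ('a \<Rightarrow> 'b::euclidean_space) \<Rightarrow> bool" where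
  "Ck_on 0 S f \<longleftrightarrow> continuous_on S f"
| "Ck_on (Suc k) S f \<longleftrightarrow>
     (\<forall>x\<in>S. f differentiable at x) \<and> (\<forall>v. Ck_on k S (\<lambda>x. frechet_derivative f (at x) v))"

definition smooth_on :: "'a::euclidean_space set \<Rightarrow> ('a \<Rightarrow> 'b::euclidean_space) \<Rightarrow> bool" where
  "smooth_on S f \<longleftrightarrow> (\<forall>k. Ck_on k S f)"


section \<open>Smooth manifolds and compact Lie groups\<close>

text \<open>
  A chart is a pair of its domain and its coordinate map; values of the coordinate map outside
  the domain are irrelevant. An atlas need not be maximal.
\<close>

type_synonym ('a, 'e) chart = "'a set \<times> ('a \<Rightarrow> 'e)"

definition is_chart :: "'a topology \<Rightarrow> ('a, 'e::euclidean_space) chart \<Rightarrow> bool" where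
  "is_chart T c \<longleftrightarrow> (case c of (D, \<phi>) \<Rightarrow>
     openin T D \<and> open (\<phi> ` D) \<and>
     homeomorphic_map (subtopology T D) (top_of_set (\<phi> ` D)) \<phi>)"

definition smooth_atlas :: "'a topology \<Rightarrow> ('a, 'e::euclidean_space) chart set \<Rightarrow> bool" where
  "smooth_atlas T A \<longleftrightarrow>
     (\<forall>c\<in>A. is_chart T c) \<and>
     (\<Union>(D, \<phi>)\<in>A. D) = topspace T \<and>
     (\<forall>(D, \<phi>)\<in>A. \<forall>(E, \<eta>)\<in>A. smooth_on (\<phi> ` (D \<inter> E)) (\<eta> \<circ> inv_into D \<phi>))"

definition smooth_manifold :: "'a topology \<Rightarrow> ('a, 'e::euclidean_space) chart set \<Rightarrow> bool" where
  "smooth_manifold T A \<longleftrightarrow> Hausdorff_space T \<and> second_countable T \<and> smooth_atlas T A"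

definition smooth_map ::
  "'a topology \<Rightarrow> ('a, 'e::euclidean_space) chart set \<Rightarrow>
   'b topology \<Rightarrow> ('b, 'f::euclidean_space) chart set \<Rightarrow> ('a \<Rightarrow> 'b) \<Rightarrow> bool" where
  "smooth_map T A T' B f \<longleftrightarrow>
     continuous_map T T' f \<and>
     (\<forall>(D, \<phi>)\<in>A. \<forall>(E, \<eta>)\<in>B.
        smooth_on (\<phi> ` {x \<in> D. f x \<in> E}) (\<eta> \<circ> f \<circ> inv_into D \<phi>))"

definition prod_atlas ::
  "('a, 'e) chart set \<Rightarrow> ('b, 'f) chart set \<Rightarrow> ('a \<times> 'b, 'e \<times> 'f) chart set" where
  "prod_atlas A B = {(D \<times> E, map_prod \<phi> \<eta>) | D \<phi> E \<eta>. (D, \<phi>) \<in> A \<and> (E, \<eta>) \<in> B}"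

text \<open>
  Since every \<^class>\<open>euclidean_space\<close> has positive dimension, the Lie groups below have positive
  dimension. The compact Lie groups of dimension zero are exactly the finite groups with the
  discrete topology, which are treated separately.
\<close>

definition compact_lie_group ::
  "('g, 'm) monoid_scheme \<Rightarrow> 'g topology \<Rightarrow> ('g, 'e::euclidean_space) chart set \<Rightarrow> bool" where
  "compact_lie_group G T A \<longleftrightarrow>
     group G \<and> topspace T = carrier G \<and> compact_space T \<and> smooth_manifold T A \<and>
     smooth_map (prod_topology T T) (prod_atlas A A) T A (\<lambda>(x, y). x \<otimes>\<^bsub>G\<^esub> y) \<and>
     smooth_map T A T A (\<lambda>x. inv\<^bsub>G\<^esub> x)"

definition finite_discrete_group :: "('g, 'm) monoid_scheme \<Rightarrow> 'g topology \<Rightarrow> bool" where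
  "finite_discrete_group G T \<longleftrightarrow>
     group G \<and> finite (carrier G) \<and> T = discrete_topology (carrier G)"


section \<open>Unitary representations\<close>

text \<open>
  Representations are strongly continuous, which is no restriction for discrete groups.
  \<open>U \<one> = id\<close> follows from multiplicativity, because \<open>U \<one>\<close> is invertible.
\<close>

definition unitary_rep ::
  "('g, 'm) monoid_scheme \<Rightarrow> 'g topology \<Rightarrow> ('g \<Rightarrow> 'h::chilbert_space \<Rightarrow> 'h) \<Rightarrow> bool" where
  "unitary_rep G T U \<longleftrightarrow>
     (\<forall>g\<in>carrier G. unitary (U g)) \<and>
     (\<forall>g\<in>carrier G. \<forall>h\<in>carrier G. U (g \<otimes>\<^bsub>G\<^esub> h) = U g \<circ> U h) \<and>
     (\<forall>x. continuous_map T euclidean (\<lambda>g. U g x))"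

definition commutator :: "('h::ab_group_add \<Rightarrow> 'h) \<Rightarrow> ('h \<Rightarrow> 'h) \<Rightarrow> 'h \<Rightarrow> 'h" where
  "commutator V W = (\<lambda>x. V (W x) - W (V x))"

definition G_invariant ::
  "('g, 'm) monoid_scheme \<Rightarrow> ('g \<Rightarrow> 'h::chilbert_space \<Rightarrow> 'h) \<Rightarrow> ('h \<Rightarrow> 'h) \<Rightarrow> bool" where
  "G_invariant G U V \<longleftrightarrow> (\<forall>g\<in>carrier G. commutator V (U g) = (\<lambda>x. 0))"

end

theory Submission
  imports Defs
begin

text \<open>
  The nontrivial direction extends the partial isometry \<open>U g \<psi> \<mapsto> U g \<phi>\<close>, which intertwines the
  representation, to an invariant unitary. Let \<open>K\<close> be the closed subspace generated by the orbits of
  \<open>\<psi>\<close> and \<open>\<phi>\<close>. By Zorn's lemma there is a maximal isometric intertwiner \<open>\<Gamma>\<close>, given by its graph, that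
  extends this partial isometry and the identity on \<open>K\<^sup>\<bottom>\<close>. If its range is not everything, the
  orthogonal complement of the range contains a nonzero finite-dimensional invariant subspace \<open>E\<close>.
  If all powers \<open>\<Gamma>\<^sup>k\<close> are defined on \<open>E\<close>, their images are infinitely many
  orthogonal copies of \<open>E\<close> in \<open>K\<close>, but the multiplicity of a finite-dimensional
  representation in a finitely generated one is finite. Otherwise some \<open>\<Gamma>\<^sup>k\<close> followed by the projection to
  the complement of the domain of \<open>\<Gamma>\<close> is a nonzero intertwiner on \<open>E\<close>, which yields a proper extension
  of \<open>\<Gamma>\<close>. The domain is treated by passing to the inverse of \<open>\<Gamma>\<close>.

  The subspace \<open>E\<close> is an eigenspace of a nonzero compact symmetric operator commuting with the
  representation. Instead of averaging \<open>|U g y\<rangle>\<langle>U g y|\<close> with a Haar measure, this operator is obtained as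
  a common fixed point of the conjugation action on the norm-compact closed convex hull of these
  rank-one operators. Of the group, only the compactness of its orbits is used.
\<close>

section \<open>Complex Hilbert spaces\<close>

interpretation C: vector_space "scaleC :: complex \<Rightarrow> 'a \<Rightarrow> 'a::chilbert_space"
  by unfold_locales (simp_all add: scaleC_add_right scaleC_add_left scaleC_scaleC
      scaleC_of_real[of 1, simplified])

lemma cinner_add_left: "cinner (x + y) z = cinner x z + cinner y z"
  for x y z :: "'a::chilbert_space"
  by (metis cinner_add_right cinner_commute complex_cnj_add)

lemma cinner_scaleC_left: "cinner (a *\<^sub>C x) y = cnj a * cinner x y"
  for x y :: "'a::chilbert_space"
  by (metis cinner_commute cinner_scaleC_right complex_cnj_mult)

lemma cinner_scaleR_right: "cinner x (r *\<^sub>R y) = r *\<^sub>R cinner x y"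
  for x y :: "'a::chilbert_space"
  by (simp add: scaleC_of_real[symmetric] cinner_scaleC_right scaleR_conv_of_real)

lemma cinner_scaleR_left: "cinner (r *\<^sub>R x) y = r *\<^sub>R cinner x y"
  for x y :: "'a::chilbert_space"
  by (simp add: scaleC_of_real[symmetric] cinner_scaleC_left scaleR_conv_of_real)

lemma additive_cinner_right: "Modules.additive (cinner (x::'a::chilbert_space))"
  by unfold_locales (rule cinner_add_right)

lemma additive_cinner_left: "Modules.additive (\<lambda>x. cinner x (y::'a::chilbert_space))"
  by unfold_locales (rule cinner_add_left)

lemmas cinner_zero_right [simp] = Modules.additive.zero[OF additive_cinner_right]
lemmas cinner_zero_left [simp] = Modules.additive.zero[OF additive_cinner_left]
lemmas cinner_diff_right = Modules.additive.diff[OF additive_cinner_right]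
lemmas cinner_diff_left = Modules.additive.diff[OF additive_cinner_left]
lemmas cinner_sum_right = Modules.additive.sum[OF additive_cinner_right]

lemma norm_sq_cinner: "(norm x)\<^sup>2 = Re (cinner x x)" for x :: "'a::chilbert_space"
  by (simp add: cinner_self)

lemma Re_cinner_commute: "Re (cinner x y) = Re (cinner y x)" for x y :: "'a::chilbert_space"
  by (metis cinner_commute cnj.simps(1))

lemma norm_add_sq: "(norm (x + y))\<^sup>2 = (norm x)\<^sup>2 + 2 * Re (cinner x y) + (norm y)\<^sup>2"
  for x y :: "'a::chilbert_space"
  using Re_cinner_commute[of x y] by (simp add: norm_sq_cinner cinner_add_left cinner_add_right)

lemma norm_diff_sq: "(norm (x - y))\<^sup>2 = (norm x)\<^sup>2 - 2 * Re (cinner x y) + (norm y)\<^sup>2"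
  for x y :: "'a::chilbert_space"
  using Re_cinner_commute[of x y] by (simp add: norm_sq_cinner cinner_diff_left cinner_diff_right)

lemma parallelogram:
  "(norm (x + y))\<^sup>2 + (norm (x - y))\<^sup>2 = 2 * (norm x)\<^sup>2 + 2 * (norm y)\<^sup>2"
  for x y :: "'a::chilbert_space"
  by (simp add: norm_add_sq norm_diff_sq)

lemma cinner_self_eq_0 [simp]: "cinner x x = 0 \<longleftrightarrow> x = 0" for x :: "'a::chilbert_space"
  by (simp add: cinner_self)

lemma norm_scaleC: "norm (a *\<^sub>C x) = cmod a * norm x" for x :: "'a::chilbert_space"
proof -
  have "complex_of_real ((norm (a *\<^sub>C x))\<^sup>2) = (a * cnj a) * complex_of_real ((norm x)\<^sup>2)"
    by (simp only: cinner_self[symmetric]) (simp add: cinner_scaleC_left cinner_scaleC_right)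
  also have "\<dots> = complex_of_real ((cmod a * norm x)\<^sup>2)"
    by (simp add: complex_norm_square power_mult_distrib del: of_real_power)
  finally have "(norm (a *\<^sub>C x))\<^sup>2 = (cmod a * norm x)\<^sup>2"
    using of_real_eq_iff by blast
  then show ?thesis by (simp add: power2_eq_iff_nonneg)
qed

lemma norm_add_sq_orthogonal:
  "cinner x y = 0 \<Longrightarrow> (norm (x + y))\<^sup>2 = (norm x)\<^sup>2 + (norm y)\<^sup>2"
  for x y :: "'a::chilbert_space"
  by (simp add: norm_add_sq)

lemma norm_cinner_le: "cmod (cinner x y) \<le> norm x * norm y" for x y :: "'a::chilbert_space"
proof (cases "x = 0")
  case False
  \<comment> \<open>\<open>c *\<^sub>C x\<close> is the orthogonal projection of \<open>y\<close>
    onto the line through \<open>x\<close>; Pythagoras bounds its norm by that of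
    \<open>y\<close>.\<close>
  define c where "c = cinner x y / complex_of_real ((norm x)\<^sup>2)"
  have "cinner x (y - c *\<^sub>C x) = 0"
    using False by (simp add: cinner_diff_right cinner_scaleC_right cinner_self c_def)
  then have "cinner (c *\<^sub>C x) (y - c *\<^sub>C x) = 0" by (simp add: cinner_scaleC_left)
  from norm_add_sq_orthogonal[OF this] have "(norm (c *\<^sub>C x))\<^sup>2 \<le> (norm y)\<^sup>2" by simp
  then have "cmod c * norm x \<le> norm y" by (simp add: norm_scaleC)
  moreover have "cmod c = cmod (cinner x y) / (norm x)\<^sup>2"
    by (simp add: c_def norm_divide norm_power)
  ultimately show ?thesis using False by (simp add: power2_eq_square field_simps)
qed auto

lemma bounded_bilinear_cinner: "bounded_bilinear (cinner :: 'a::chilbert_space \<Rightarrow> _)"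
proof
  show "\<exists>K. \<forall>a b::'a. cmod (cinner a b) \<le> norm a * norm b * K"
    by (rule exI[of _ 1]) (simp add: norm_cinner_le)
qed (simp_all add: cinner_add_left cinner_add_right cinner_scaleR_left cinner_scaleR_right)

lemma bounded_bilinear_scaleC: "bounded_bilinear (scaleC :: complex \<Rightarrow> 'a \<Rightarrow> 'a::chilbert_space)"
proof
  show "\<exists>K. \<forall>a b. norm (a *\<^sub>C b :: 'a) \<le> norm a * norm b * K"
    by (rule exI[of _ 1]) (simp add: norm_scaleC)
qed (simp_all add: C.scale_left_distrib C.scale_right_distrib scaleC_of_real[symmetric]
      scaleR_conv_of_real mult.commute)

lemmas continuous_on_cinner [continuous_intros] =
  bounded_bilinear.continuous_on[OF bounded_bilinear_cinner]
lemmas tendsto_scaleC [tendsto_intros] = bounded_bilinear.tendsto[OF bounded_bilinear_scaleC]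
lemmas continuous_on_scaleC [continuous_intros] =
  bounded_bilinear.continuous_on[OF bounded_bilinear_scaleC]

lemma C_subspace_imp_subspace: "C.subspace M \<Longrightarrow> subspace (M :: 'a::chilbert_space set)"
  by (auto simp: subspace_def C.subspace_def scaleC_of_real[symmetric])

text \<open>A minimizing sequence for the distance from \<open>x\<close> is Cauchy by the
  parallelogram law, because midpoints stay in \<open>M\<close>. Its limit \<open>p\<close> is a
  nearest point, and moving \<open>p\<close> along any \<open>m\<close> in \<open>M\<close> cannot
  decrease the distance, which forces orthogonality.\<close>

lemma orthogonal_projection_exists:
  fixes M :: "'a::chilbert_space set"
  assumes sub: "C.subspace M" and "closed M"
  shows "\<exists>p\<in>M. \<forall>m\<in>M. cinner m (x - p) = 0"
proof -
  define d where "d = (INF m\<in>M. (norm (x - m))\<^sup>2)"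
  have M0: "M \<noteq> {}" using sub C.subspace_0 by auto
  have bdd: "bdd_below ((\<lambda>m. (norm (x - m))\<^sup>2) ` M)" by (rule bdd_belowI[of _ 0]) auto
  have d_le: "d \<le> (norm (x - m))\<^sup>2" if "m \<in> M" for m
    unfolding d_def by (rule cINF_lower[OF bdd that])
  have "\<exists>m\<in>M. (norm (x - m))\<^sup>2 < d + inverse (Suc n)" for n
  proof -
    have "d < d + inverse (Suc n)" by simp
    then show ?thesis unfolding d_def using cINF_less_iff[OF M0 bdd] by blast
  qed
  then obtain s where sM: "\<And>n. s n \<in> M"
    and s: "\<And>n. (norm (x - s n))\<^sup>2 < d + inverse (real (Suc n))"
    by metis
  have close: "(norm (s m - s n))\<^sup>2 \<le> 2 * (inverse (real (Suc m)) + inverse (real (Suc n)))" for m n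
  proof -
    have "(1/2) *\<^sub>R (s m + s n) \<in> M"
      using sM C_subspace_imp_subspace[OF sub] by (simp add: subspace_add subspace_scale)
    then have "d \<le> (norm (x - (1/2) *\<^sub>R (s m + s n)))\<^sup>2" by (rule d_le)
    also have "x - (1/2) *\<^sub>R (s m + s n) = (1/2) *\<^sub>R ((x - s m) + (x - s n))"
      by (simp add: algebra_simps flip: scaleR_add_left)
    finally have "4 * d \<le> (norm ((x - s m) + (x - s n)))\<^sup>2"
      by (simp add: power_mult_distrib power_divide)
    moreover have "(norm ((x - s m) + (x - s n)))\<^sup>2 + (norm (s n - s m))\<^sup>2
        = 2 * (norm (x - s m))\<^sup>2 + 2 * (norm (x - s n))\<^sup>2"
      using parallelogram[of "x - s m" "x - s n"] by (simp add: algebra_simps)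
    ultimately show ?thesis using s[of m] s[of n] by (simp add: norm_minus_commute)
  qed
  have "Cauchy s"
  proof (rule metric_CauchyI)
    fix e :: real assume "e > 0"
    then have "e\<^sup>2 / 4 > 0" by simp
    then obtain N where N: "inverse (real (Suc N)) < e\<^sup>2 / 4" using reals_Archimedean by blast
    have "dist (s m) (s n) < e" if "m \<ge> N" "n \<ge> N" for m n
    proof -
      have "inverse (real (Suc m)) \<le> inverse (real (Suc N))"
        "inverse (real (Suc n)) \<le> inverse (real (Suc N))"
        using that by (simp_all add: le_imp_inverse_le)
      then have "(norm (s m - s n))\<^sup>2 < e\<^sup>2" using close[of m n] N by argo
      then show ?thesis using \<open>e > 0\<close> by (simp add: dist_norm power_less_imp_less_base)
    qed
    then show "\<exists>M. \<forall>m\<ge>M. \<forall>n\<ge>M. dist (s m) (s n) < e" by blast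
  qed
  then obtain p where p: "s \<longlonglongrightarrow> p" using Cauchy_convergent convergent_def by blast
  then have pM: "p \<in> M" using \<open>closed M\<close> sM closed_sequentially by blast
  have "(\<lambda>n. (norm (x - s n))\<^sup>2) \<longlonglongrightarrow> (norm (x - p))\<^sup>2" by (intro tendsto_intros p)
  moreover have "(\<lambda>n. d + inverse (real (Suc n))) \<longlonglongrightarrow> d + 0"
    by (intro tendsto_intros LIMSEQ_inverse_real_of_nat)
  ultimately have p_le: "(norm (x - p))\<^sup>2 \<le> d"
    by (metis (no_types, lifting) LIMSEQ_le add.right_neutral less_imp_le s)
  have "cinner m (x - p) = 0" if m: "m \<in> M" for m
  proof (cases "m = 0")
    case False
    define c where "c = cinner m (x - p) / complex_of_real ((norm m)\<^sup>2)"
    have "cinner m ((x - p) - c *\<^sub>C m) = 0"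
      using False by (simp add: cinner_diff_right[of _ "x - p"] cinner_scaleC_right cinner_self c_def)
    then have "cinner (c *\<^sub>C m) ((x - p) - c *\<^sub>C m) = 0" by (simp add: cinner_scaleC_left)
    from norm_add_sq_orthogonal[OF this]
    have "(norm (x - p))\<^sup>2 = (norm (c *\<^sub>C m))\<^sup>2 + (norm (x - (p + c *\<^sub>C m)))\<^sup>2"
      by (simp add: algebra_simps)
    moreover have "p + c *\<^sub>C m \<in> M" using sub pM m by (simp add: C.subspace_add C.subspace_scale)
    ultimately have "(norm (c *\<^sub>C m))\<^sup>2 \<le> 0" using d_le[of "p + c *\<^sub>C m"] p_le by linarith
    then show ?thesis using False by (simp add: norm_scaleC c_def)
  qed simp
  with pM show ?thesis by blast
qed

text \<open>Polarization; stated for values of the map so that it applies to maps given by their graph.\<close>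

lemma cinner_eq_if_norm_eq:
  fixes a b c d :: "'a::chilbert_space"
  assumes "\<And>t. norm (a + t *\<^sub>C c) = norm (b + t *\<^sub>C d)"
  shows "cinner a c = cinner b d"
proof -
  have n: "norm a = norm b" using assms[of 0] by simp
  have e: "2 * Re (t * cinner a c) + (cmod t)\<^sup>2 * (norm c)\<^sup>2
      = 2 * Re (t * cinner b d) + (cmod t)\<^sup>2 * (norm d)\<^sup>2" for t
  proof -
    have "(norm (a + t *\<^sub>C c))\<^sup>2 = (norm (b + t *\<^sub>C d))\<^sup>2" using assms by simp
    then show ?thesis
      by (simp add: norm_add_sq n cinner_scaleC_right norm_scaleC power_mult_distrib)
  qed
  \<comment> \<open>The norms of \<open>c\<close> and \<open>d\<close> are not yet compared, so
    opposite values of \<open>t\<close> are used to cancel the quadratic terms: 1 and -1 give the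
    real parts, \<open>\<i>\<close> and \<open>- \<i>\<close> the imaginary parts.\<close>
  show ?thesis
    using e[of 1] e[of "-1"] e[of "\<i>"] e[of "- \<i>"] by (simp add: complex_eq_iff)
qed

lemma closed_orthogonal: "closed {x :: 'a::chilbert_space. \<forall>m\<in>M. cinner m x = 0}"
proof -
  have "{x. \<forall>m\<in>M. cinner m x = 0} = (\<Inter>m\<in>M. {x. cinner m x = 0})" by auto
  then show ?thesis
    by (auto intro!: closed_INT closed_Collect_eq continuous_intros)
qed

lemma subspace_orthogonal: "C.subspace {x :: 'a::chilbert_space. \<forall>m\<in>M. cinner m x = 0}"
  by (auto simp: C.subspace_def cinner_add_right cinner_scaleC_right)

lemma cinner_eq_0_commute: "cinner x y = 0 \<longleftrightarrow> cinner y x = 0" for x y :: "'a::chilbert_space"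
  by (metis cinner_commute complex_cnj_zero)

text \<open>The maximum set of \<open>\<parallel>F x\<parallel> / \<parallel>x\<parallel>\<close> is a subspace: this replaces eigenspaces of \<open>F\<^sup>* F\<close>.\<close>

lemma norm_attaining_set_subspace:
  fixes F :: "'a::chilbert_space \<Rightarrow> 'b::chilbert_space"
  assumes "C.subspace E"
    and add: "\<And>x y. x \<in> E \<Longrightarrow> y \<in> E \<Longrightarrow> F (x + y) = F x + F y"
    and scale: "\<And>a x. x \<in> E \<Longrightarrow> F (a *\<^sub>C x) = a *\<^sub>C F x"
    and le: "\<And>x. x \<in> E \<Longrightarrow> norm (F x) \<le> r * norm x"
  shows "C.subspace {x \<in> E. norm (F x) = r * norm x}"
proof (rule C.subspaceI)
  have F0: "F 0 = 0" using scale[of 0 0, OF C.subspace_0[OF assms(1)]] by simp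
  show "0 \<in> {x \<in> E. norm (F x) = r * norm x}"
    using C.subspace_0[OF assms(1)] F0 by simp
  show "c *\<^sub>C x \<in> {x \<in> E. norm (F x) = r * norm x}"
    if "x \<in> {x \<in> E. norm (F x) = r * norm x}" for c x
    using that assms(1) scale by (simp add: norm_scaleC C.subspace_scale)
  fix x y assume x: "x \<in> {x \<in> E. norm (F x) = r * norm x}" and y: "y \<in> {x \<in> E. norm (F x) = r * norm x}"
  have my: "- y \<in> E" "F (- y) = - F y"
    using scale[of y "-1"] y C.subspace_neg[OF assms(1)] by auto
  have xy: "x + y \<in> E" "x - y \<in> E" and F: "F (x + y) = F x + F y" "F (x - y) = F x - F y"
    using x y add add[of x "- y"] my assms(1) by (simp_all add: C.subspace_add C.subspace_diff)
  \<comment> \<open>The parallelogram law, once for \<open>F x\<close>, \<open>F y\<close> and once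
    for \<open>x\<close>, \<open>y\<close>, gives equality of the sums. By \<open>le\<close> each
    summand on the left is at most its counterpart on the right, so both are equal.\<close>
  have "(norm (F (x + y)))\<^sup>2 + (norm (F (x - y)))\<^sup>2 = (r * norm (x + y))\<^sup>2 + (r * norm (x - y))\<^sup>2"
  proof -
    have "(norm (F (x + y)))\<^sup>2 + (norm (F (x - y)))\<^sup>2 = 2 * (r * norm x)\<^sup>2 + 2 * (r * norm y)\<^sup>2"
      using x y parallelogram[of "F x" "F y"] by (simp add: F)
    also have "\<dots> = r\<^sup>2 * (2 * (norm x)\<^sup>2 + 2 * (norm y)\<^sup>2)"
      by (simp add: power_mult_distrib distrib_left mult.left_commute)
    also have "\<dots> = (r * norm (x + y))\<^sup>2 + (r * norm (x - y))\<^sup>2"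
      by (simp only: parallelogram[of x y, symmetric] power_mult_distrib distrib_left)
    finally show ?thesis .
  qed
  moreover have "(norm (F (x + y)))\<^sup>2 \<le> (r * norm (x + y))\<^sup>2" "(norm (F (x - y)))\<^sup>2 \<le> (r * norm (x - y))\<^sup>2"
    using le[OF xy(1)] le[OF xy(2)] by (simp_all add: power_mono)
  ultimately have "(norm (F (x + y)))\<^sup>2 = (r * norm (x + y))\<^sup>2" by linarith
  moreover have "0 \<le> r * norm (x + y)" using le[OF xy(1)] norm_ge_zero order_trans by blast
  ultimately show "x + y \<in> {x \<in> E. norm (F x) = r * norm x}"
    using xy by (simp add: power2_eq_iff_nonneg)
qed

section \<open>Compact convex sets in normed spaces\<close>

lemma closure_convex_hull_subset:
  fixes S :: "'a::real_normed_vector set"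
  assumes "S \<subseteq> X" "closed X" "convex X"
  shows "closure (convex hull S) \<subseteq> X"
  using assms by (simp add: closure_minimal hull_minimal)

lemma compact_imp_finite_net:
  fixes S :: "'a::metric_space set"
  assumes "compact S" "e > 0"
  shows "\<exists>F. finite F \<and> F \<subseteq> S \<and> S \<subseteq> (\<Union>x\<in>F. ball x e)"
  using seq_compact_imp_totally_bounded[of S] assms by (simp add: compact_eq_seq_compact_metric)

text \<open>Mazur's theorem. The closed convex hull stays within distance \<open>e / 4\<close> of
  the hull of a finite net, which is compact, so an \<open>e / 2\<close>-net of the latter is an
  \<open>e\<close>-net of the former.\<close>

lemma compact_closure_convex_hull:
  fixes S :: "'a::banach set"
  assumes "compact S"
  shows "compact (closure (convex hull S))"
  unfolding compact_eq_totally_bounded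
proof (intro conjI allI impI)
  show "complete (closure (convex hull S))" by (simp add: complete_eq_closed)
  fix e :: real assume e: "e > 0"
  then obtain F where F: "finite F" "F \<subseteq> S" and SF: "S \<subseteq> (\<Union>x\<in>F. ball x (e / 4))"
    using compact_imp_finite_net[OF assms, of "e / 4"] by auto
  let ?K = "convex hull F"
  let ?X = "{x + y | x y. x \<in> ?K \<and> y \<in> cball 0 (e / 4)}"
  have K: "compact ?K" using F by (simp add: finite_imp_compact_convex_hull)
  have "S \<subseteq> ?X"
  proof
    fix x assume "x \<in> S"
    then obtain f where f: "f \<in> F" "x \<in> ball f (e / 4)" using SF by auto
    then have "f \<in> ?K" "x - f \<in> cball 0 (e / 4)" by (auto simp: hull_inc dist_norm norm_minus_commute)
    moreover have "x = f + (x - f)" by simp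
    ultimately show "x \<in> ?X" by blast
  qed
  moreover have X_eq: "?X = (\<Union>x\<in>?K. \<Union>y\<in>cball 0 (e / 4). {x + y})"
    by blast
  have "closed ?X" unfolding X_eq using K by (intro compact_closed_sums) auto
  moreover have "convex ?X" unfolding X_eq by (intro convex_sums) auto
  ultimately have sub: "closure (convex hull S) \<subseteq> ?X" by (rule closure_convex_hull_subset)
  obtain k where k: "finite k" and Kk: "?K \<subseteq> (\<Union>x\<in>k. ball x (e / 2))"
    using K e unfolding compact_eq_totally_bounded by (meson half_gt_zero)
  have "?X \<subseteq> (\<Union>x\<in>k. ball x e)"
  proof
    fix z assume "z \<in> ?X"
    then obtain x y where z: "z = x + y" "x \<in> ?K" "norm y \<le> e / 4" by auto
    then obtain u where u: "u \<in> k" "dist u x < e / 2" using Kk by auto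
    have "dist u (x + y) \<le> dist u x + dist x (x + y)" by (rule dist_triangle)
    also have "\<dots> < e" using z u e by (simp add: dist_norm)
    finally show "z \<in> (\<Union>x\<in>k. ball x e)" using u z by auto
  qed
  with sub have "closure (convex hull S) \<subseteq> (\<Union>x\<in>k. ball x e)" by (rule order_trans)
  with k show "\<exists>k. finite k \<and> closure (convex hull S) \<subseteq> (\<Union>x\<in>k. ball x e)" by (intro exI conjI)
qed

text \<open>The average \<open>a\<close> of a fine net of \<open>X\<close> is strictly closer than the diameter to every point.\<close>

lemma compact_convex_normal_structure:
  fixes X :: "'a::real_normed_vector set"
  assumes X: "compact X" "convex X" "x0 \<in> X" "y0 \<in> X" "x0 \<noteq> y0"
  obtains a r where "a \<in> X" "X \<subseteq> cball a r" "\<exists>x\<in>X. \<exists>y\<in>X. dist x y > r"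
proof -
  have bX: "bounded X" using X compact_imp_bounded by blast
  let ?d = "diameter X"
  have d: "dist x y \<le> ?d" if "x \<in> X" "y \<in> X" for x y
    using diameter_bounded_bound[OF bX that] .
  have dpos: "?d > 0" using d[OF X(3,4)] X(5) zero_less_dist_iff[of x0 y0] by linarith
  then obtain F where F: "finite F" "F \<subseteq> X" and XF: "X \<subseteq> (\<Union>x\<in>F. ball x (?d / 2))"
    using compact_imp_finite_net[OF X(1), of "?d / 2"] by auto
  have Fne: "F \<noteq> {}" using XF X by auto
  define n where "n = real (card F)"
  have n: "n \<ge> 1" using F Fne by (simp add: n_def Suc_leI card_gt_0_iff)
  define a where "a = (\<Sum>f\<in>F. (1 / n) *\<^sub>R f)"
  have aX: "a \<in> X" unfolding a_def
    using F n by (intro convex_sum[OF F(1) X(2)]) (auto simp: n_def)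
  \<comment> \<open>At least one of the \<open>n\<close> net points is closer than half the diameter
    to a given \<open>x\<close>, the others at most the diameter away; the mean of these bounds is
    \<open>r\<close>.\<close>
  define r where "r = (1 - 1 / (2 * n)) * ?d"
  have "dist a x \<le> r" if x: "x \<in> X" for x
  proof -
    obtain f0 where f0: "f0 \<in> F" "dist f0 x < ?d / 2" using XF x by auto
    have "a - x = (\<Sum>f\<in>F. (1 / n) *\<^sub>R (f - x))"
      using n by (simp add: a_def scaleR_diff_right sum_subtractf n_def sum_constant_scaleR)
    then have "norm (a - x) \<le> (\<Sum>f\<in>F. (1 / n) * dist f x)"
      using norm_sum[of "\<lambda>f. (1 / n) *\<^sub>R (f - x)" F] n by (simp add: dist_norm)
    also have "\<dots> = (1 / n) * dist f0 x + (\<Sum>f\<in>F - {f0}. (1 / n) * dist f x)"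
      using F f0 by (simp add: sum.remove)
    also have "\<dots> \<le> (1 / n) * (?d / 2) + (\<Sum>f\<in>F - {f0}. (1 / n) * ?d)"
      using f0 n F x d by (intro add_mono sum_mono mult_left_mono) auto
    also have "(\<Sum>f\<in>F - {f0}. (1 / n) * ?d) = (n - 1) / n * ?d"
      using F f0 n by (simp add: n_def of_nat_diff)
    also have "(1 / n) * (?d / 2) + (n - 1) / n * ?d = r"
      using n by (simp add: r_def field_simps)
    finally show ?thesis by (simp add: dist_norm)
  qed
  then have "X \<subseteq> cball a r" by auto
  moreover have "r < ?d" using dpos n by (simp add: r_def field_simps)
  then have "\<exists>x\<in>X. \<exists>y\<in>X. dist x y > r"
    using diameter_compact_attained[OF X(1)] X(3) by force
  ultimately show thesis using that aX by blast
qed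

text \<open>A minimal nonempty closed convex stable subset \<open>X\<close> of \<open>K\<close> is a
  single point: otherwise normal structure yields a radius for which the points that see all of
  \<open>X\<close> within that radius form a smaller such set. Its stability uses
  \<open>inv\<close>, as every \<open>z\<close> in \<open>X\<close> is the image of a point of
  \<open>X\<close>.\<close>

lemma common_fixed_point_isometries:
  fixes K :: "'a::real_normed_vector set" and \<Phi> :: "'i \<Rightarrow> 'a \<Rightarrow> 'a"
  assumes K: "compact K" "convex K" "K \<noteq> {}"
    and maps: "\<And>i. i \<in> I \<Longrightarrow> \<Phi> i ` K \<subseteq> K"
    and lin: "\<And>i. i \<in> I \<Longrightarrow> linear (\<Phi> i)"
    and iso: "\<And>i x. i \<in> I \<Longrightarrow> norm (\<Phi> i x) = norm x"
    and inv: "\<And>i. i \<in> I \<Longrightarrow> \<exists>j\<in>I. \<forall>x. \<Phi> i (\<Phi> j x) = x"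
  obtains p where "p \<in> K" "\<And>i. i \<in> I \<Longrightarrow> \<Phi> i p = p"
proof -
  define good where "good X \<longleftrightarrow> X \<subseteq> K \<and> closed X \<and> convex X \<and> X \<noteq> {} \<and> (\<forall>i\<in>I. \<Phi> i ` X \<subseteq> X)" for X
  have dist_eq: "dist (\<Phi> i x) (\<Phi> i y) = dist x y" if "i \<in> I" for i x y
    using iso[OF that, of "x - y"] lin[OF that] by (simp add: dist_norm linear_diff)
  \<comment> \<open>Zorn's lemma produces maximal elements, so it is applied to the complements of
    good sets. Unions of chains become intersections, which are nonempty by compactness of
    \<open>K\<close>.\<close>
  have "\<exists>M\<in>{X. good (- X)}. \<forall>X\<in>{X. good (- X)}. M \<subseteq> X \<longrightarrow> X = M"
  proof (rule subset_Zorn_nonempty)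
    have "good K" using K maps by (simp add: good_def compact_imp_closed)
    then have "- K \<in> {X. good (- X)}" by simp
    then show "{X. good (- X)} \<noteq> {}" by blast
    fix \<C> assume C: "\<C> \<noteq> {}" "subset.chain {X. good (- X)} \<C>"
    have g: "good (- X)" if "X \<in> \<C>" for X using C that by (auto simp: subset_chain_def)
    have "(\<Inter>X\<in>\<C>. - X) \<noteq> {}"
    proof -
      have "K \<inter> (\<Inter>X\<in>\<C>. - X) \<noteq> {}"
      proof (rule compact_imp_fip_image[OF K(1)])
        show "closed (- X)" if "X \<in> \<C>" for X using g[OF that] by (simp add: good_def)
        fix \<D> assume D: "finite \<D>" "\<D> \<subseteq> \<C>"
        show "K \<inter> (\<Inter>X\<in>\<D>. - X) \<noteq> {}"
        proof (cases "\<D> = {}")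
          case False
          have "\<Union>\<D> \<in> \<D>" using Union_in_chain[OF D(1) False] C(2) D(2) subset_chain_def
            by (metis subset.chain_def subset_trans subsetD)
          then have "good (- \<Union>\<D>)" using D g by blast
          then obtain x where "x \<in> - \<Union>\<D>" "x \<in> K" unfolding good_def by blast
          then show ?thesis by blast
        qed (use K in simp)
      qed
      then show ?thesis by blast
    qed
    moreover have "(\<Inter>X\<in>\<C>. - X) \<subseteq> K" using C g unfolding good_def by blast
    moreover have "closed (\<Inter>X\<in>\<C>. - X)" using g unfolding good_def by (intro closed_INT) blast
    moreover have "convex (\<Inter>X\<in>\<C>. - X)" using g unfolding good_def by (intro convex_INT) blast
    moreover have "\<Phi> i ` (\<Inter>X\<in>\<C>. - X) \<subseteq> (\<Inter>X\<in>\<C>. - X)" if "i \<in> I" for i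
      using g that unfolding good_def by blast
    moreover have "- \<Union>\<C> = (\<Inter>X\<in>\<C>. - X)" by blast
    ultimately show "\<Union>\<C> \<in> {X. good (- X)}" unfolding good_def by simp
  qed
  then obtain X0 where "good (- X0)" and max0: "\<And>X. good (- X) \<Longrightarrow> X0 \<subseteq> X \<Longrightarrow> X = X0" by auto
  then obtain X where X: "good X" and min: "\<And>Y. good Y \<Longrightarrow> Y \<subseteq> X \<Longrightarrow> Y = X"
    by (metis Compl_subset_Compl_iff double_complement)
  have cX: "compact X" using X K by (metis compact_Int_closed good_def inf.absorb2)
  have "\<exists>p. X = {p}"
  proof (rule ccontr)
    assume "\<nexists>p. X = {p}"
    moreover obtain x0 where x0: "x0 \<in> X" using X unfolding good_def by blast
    ultimately obtain y0 where "y0 \<in> X" "x0 \<noteq> y0"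
      by (metis insert_absorb insert_iff is_singletonI' is_singleton_the_elem)
    with x0 obtain a r where a: "a \<in> X" "X \<subseteq> cball a r" "\<exists>x\<in>X. \<exists>y\<in>X. dist x y > r"
      using compact_convex_normal_structure[OF cX] X unfolding good_def by blast
    \<comment> \<open>\<open>Y\<close> contains the centre \<open>a\<close> but misses a point of
      \<open>X\<close>, because two points of \<open>X\<close> are more than \<open>r\<close>
      apart.\<close>
    define Y where "Y = X \<inter> (\<Inter>z\<in>X. cball z r)"
    have "\<Phi> i x \<in> Y" if i: "i \<in> I" and x: "x \<in> Y" for i x
    proof -
      obtain j where j: "j \<in> I" "\<And>x. \<Phi> i (\<Phi> j x) = x" using inv[OF i] by blast
      have "dist z (\<Phi> i x) \<le> r" if "z \<in> X" for z
      proof -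
        have "\<Phi> j z \<in> X" using X j that unfolding good_def by blast
        then have "dist (\<Phi> j z) x \<le> r" using x by (simp add: Y_def)
        then show ?thesis using dist_eq[OF i, of "\<Phi> j z" x] j by simp
      qed
      moreover have "\<Phi> i x \<in> X" using x X i unfolding Y_def good_def by blast
      ultimately show ?thesis by (simp add: Y_def)
    qed
    moreover have "a \<in> Y" using a by (auto simp: Y_def dist_commute)
    ultimately have "good Y" using X unfolding good_def
      by (auto simp: Y_def intro!: closed_Int closed_INT convex_Int convex_INT)
    then have YX: "Y = X" using min[of Y] by (simp add: Y_def)
    obtain x y where xy: "x \<in> X" "y \<in> X" "dist x y > r" using a by blast
    then have "y \<in> Y" using YX by simp
    then have "dist x y \<le> r" using xy by (simp add: Y_def)
    with xy show False by simp
  qed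
  then obtain p where "X = {p}" ..
  then show thesis using that X unfolding good_def by auto
qed

section \<open>Compact symmetric operators\<close>

text \<open>The functionals given by \<open>F\<close> separate the points of \<open>E\<close>, and
  imposing one more equation \<open>cinner z x = 0\<close> lowers the dimension by at most one. The
  induction therefore adds at most one spanning vector per element of \<open>F\<close>.\<close>

lemma subspace_finite_span:
  fixes E F :: "'a::chilbert_space set"
  assumes "finite F" "C.subspace E" "\<And>x. x \<in> E \<Longrightarrow> \<forall>z\<in>F. cinner z x = 0 \<Longrightarrow> x = 0"
  shows "\<exists>B. finite B \<and> B \<subseteq> E \<and> E \<subseteq> C.span B"
  using assms
proof (induction F arbitrary: E)
  case empty
  then have "E \<subseteq> C.span {}" by auto
  then show ?case by blast
next
  case (insert z F)
  let ?E = "{x \<in> E. cinner z x = 0}"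
  have "C.subspace ?E"
    using insert.prems(1) by (auto simp: C.subspace_def cinner_add_right cinner_scaleC_right)
  then obtain B where B: "finite B" "B \<subseteq> ?E" "?E \<subseteq> C.span B"
    using insert.IH[of ?E] insert.prems(2) by auto
  show ?case
  proof (cases "E \<subseteq> ?E")
    case True
    then show ?thesis using B by blast
  next
    case False
    then obtain e where e: "e \<in> E" "cinner z e \<noteq> 0" by blast
    have "x \<in> C.span (insert e B)" if x: "x \<in> E" for x
    proof -
      define c where "c = cinner z x / cinner z e"
      have "x - c *\<^sub>C e \<in> ?E"
        using x e insert.prems(1)
        by (simp add: c_def C.subspace_diff C.subspace_scale cinner_diff_right cinner_scaleC_right)
      then have "x - c *\<^sub>C e \<in> C.span (insert e B)"
        using B C.span_mono[of B "insert e B"] by blast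
      then have "(x - c *\<^sub>C e) + c *\<^sub>C e \<in> C.span (insert e B)"
        by (intro C.span_add C.span_scale[OF C.span_base]) simp_all
      then show ?thesis by simp
    qed
    then have "finite (insert e B) \<and> insert e B \<subseteq> E \<and> E \<subseteq> C.span (insert e B)"
      using B e by blast
    then show ?thesis by blast
  qed
qed

text \<open>The last assumption says that \<open>Q\<close> is a norm limit of operators of finite rank.\<close>

locale compact_symmetric =
  fixes Q :: "'h::chilbert_space \<Rightarrow>\<^sub>L 'h"
  assumes nonzero: "Q \<noteq> 0"
    and scale: "\<And>a x. Q (a *\<^sub>C x) = a *\<^sub>C Q x"
    and symmetric: "\<And>x y. cinner (Q x) y = cinner x (Q y)"
    and compact: "compact (closure (Q ` cball 0 1))"
    and finite_rank_approx:
      "\<And>e. e > 0 \<Longrightarrow> \<exists>F. finite F \<and> (\<forall>x. (\<forall>z\<in>F. cinner z x = 0) \<longrightarrow> norm (Q x) \<le> e * norm x)"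
begin

text \<open>This is the eigenspace of the square of \<open>Q\<close> for the eigenvalue
  \<open>(norm Q)\<^sup>2\<close>, that is, the sum of the eigenspaces of \<open>Q\<close> for
  \<open>norm Q\<close> and \<open>- norm Q\<close>. In the form with norms it is a subspace by
  \<open>norm_attaining_set_subspace\<close>.\<close>

definition top_eigenspace :: "'h set" where
  "top_eigenspace = {x. norm (Q x) = norm Q * norm x}"

lemma subspace_top_eigenspace: "C.subspace top_eigenspace"
  using norm_attaining_set_subspace[of UNIV "blinfun_apply Q" "norm Q"]
  by (simp add: top_eigenspace_def C.subspace_UNIV blinfun.add_right scale norm_blinfun)

lemma norm_Q_pos: "norm Q > 0"
  using nonzero by simp

text \<open>Symmetry evaluates the mixed term in the squared norm of the difference of the two
  sides, and the operator norm bounds \<open>Q (Q x)\<close>; together they make this square at most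
  0.\<close>

lemma Q_Q_top_eigenspace:
  assumes "x \<in> top_eigenspace"
  shows "Q (Q x) = (norm Q)\<^sup>2 *\<^sub>R x"
proof -
  let ?l = "norm Q"
  have x: "norm (Q x) = ?l * norm x" using assms by (simp add: top_eigenspace_def)
  have "cinner (Q (Q x)) x = cinner (Q x) (Q x)" by (rule symmetric)
  then have 1: "Re (cinner (Q (Q x)) (?l\<^sup>2 *\<^sub>R x)) = ?l\<^sup>2 * (?l * norm x)\<^sup>2"
    by (simp add: cinner_scaleR_right norm_sq_cinner[symmetric] x)
  have "norm (Q (Q x)) \<le> ?l * (?l * norm x)" using norm_blinfun[of Q "Q x"] by (simp add: x)
  then have "(norm (Q (Q x)))\<^sup>2 \<le> (?l * (?l * norm x))\<^sup>2" by (rule power_mono) simp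
  then have "(norm (Q (Q x) - ?l\<^sup>2 *\<^sub>R x))\<^sup>2 \<le> 0"
    unfolding norm_diff_sq 1 by (simp add: power2_eq_square mult_ac)
  then show ?thesis by simp
qed

text \<open>Take \<open>w\<close> of maximal norm in the compact closure of the image of the unit
  ball, so that \<open>norm Q \<le> norm w\<close>. Symmetry gives
  \<open>(norm (Q x))\<^sup>2 \<le> norm (Q (Q x))\<close> on the ball; passing to the closure,
  \<open>(norm w)\<^sup>2 \<le> norm (Q w)\<close>, so \<open>Q\<close> attains its norm at
  \<open>w\<close>.\<close>

lemma top_eigenspace_nontrivial: "\<exists>w\<in>top_eigenspace. w \<noteq> 0"
proof -
  let ?D = "closure (Q ` cball 0 1)"
  have "?D \<noteq> {}" by simp
  then obtain w where w: "w \<in> ?D" and max: "\<And>z. z \<in> ?D \<Longrightarrow> norm z \<le> norm w"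
    using distance_attains_sup[OF compact, of 0] by auto
  have "norm Q \<le> norm w"
  proof (rule norm_blinfun_bound)
    fix x
    show "norm (Q x) \<le> norm w * norm x"
    proof (cases "x = 0")
      case False
      have "Q ((1 / norm x) *\<^sub>R x) \<in> ?D" by (rule closure_subset[THEN subsetD], rule imageI) simp
      from max[OF this] show ?thesis using False by (simp add: blinfun.scaleR_right field_simps)
    qed simp
  qed simp
  have "?D \<subseteq> {w. (norm w)\<^sup>2 \<le> norm (Q w)}"
  proof (rule closure_minimal)
    show "closed {w. (norm w)\<^sup>2 \<le> norm (Q w)}"
      by (intro closed_Collect_le continuous_intros)
    show "Q ` cball 0 1 \<subseteq> {w. (norm w)\<^sup>2 \<le> norm (Q w)}"
    proof safe
      fix x :: 'h assume x: "x \<in> cball 0 1"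
      have "(norm (Q x))\<^sup>2 = Re (cinner (Q (Q x)) x)" by (simp add: norm_sq_cinner symmetric)
      also have "\<dots> \<le> norm (Q (Q x)) * norm x"
        using complex_Re_le_cmod norm_cinner_le order_trans by blast
      also have "\<dots> \<le> norm (Q (Q x))" using x by (simp add: mult_left_le)
      finally show "(norm (Q x))\<^sup>2 \<le> norm (Q (Q x))" .
    qed
  qed
  then have "norm w * norm w \<le> norm (Q w)" using w by (auto simp: power2_eq_square)
  moreover have "norm Q * norm w \<le> norm w * norm w"
    using \<open>norm Q \<le> norm w\<close> by (simp add: mult_right_mono)
  ultimately have "norm (Q w) = norm Q * norm w" using norm_blinfun[of Q w] by simp
  moreover have "w \<noteq> 0" using \<open>norm Q \<le> norm w\<close> norm_Q_pos by auto
  ultimately show ?thesis by (auto simp: top_eigenspace_def)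
qed

text \<open>By \<open>Q_Q_top_eigenspace\<close> a unit vector here is, up to the factor
  \<open>1 / norm Q\<close>, the image of another unit vector. The sphere is thus a closed subset of
  a rescaled compact set.\<close>

lemma compact_sphere_top_eigenspace: "compact (top_eigenspace \<inter> sphere 0 1)"
proof -
  let ?l = "norm Q" and ?D = "closure (Q ` cball 0 1)"
  have "top_eigenspace \<inter> sphere 0 1 \<subseteq> (\<lambda>x. (1 / ?l) *\<^sub>R x) ` ?D"
  proof
    fix x assume x: "x \<in> top_eigenspace \<inter> sphere 0 1"
    then have "norm ((1 / ?l) *\<^sub>R Q x) = 1" using norm_Q_pos by (simp add: top_eigenspace_def)
    then have "Q ((1 / ?l) *\<^sub>R Q x) \<in> ?D" by (intro closure_subset[THEN subsetD] imageI) simp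
    moreover have "x = (1 / ?l) *\<^sub>R Q ((1 / ?l) *\<^sub>R Q x)"
      using x Q_Q_top_eigenspace[of x] norm_Q_pos
      by (simp add: blinfun.scaleR_right power2_eq_square)
    ultimately show "x \<in> (\<lambda>x. (1 / ?l) *\<^sub>R x) ` ?D" by blast
  qed
  moreover have "sphere 0 1 = {x :: 'h. norm x = 1}" by auto
  then have "closed (top_eigenspace \<inter> sphere 0 1)" unfolding top_eigenspace_def
    by (simp only:) (intro closed_Int closed_Collect_eq continuous_intros)
  ultimately show ?thesis
    using compact_scaling[OF compact] compact_Int_closed by (metis inf.absorb2)
qed

text \<open>Up to an error of half its norm, \<open>Q\<close> vanishes on the complement of a finite
  set, while on this eigenspace it attains its norm; so the finite set separates the points of the
  eigenspace.\<close>

lemma finite_span_top_eigenspace: "\<exists>B. finite B \<and> B \<subseteq> top_eigenspace \<and> top_eigenspace \<subseteq> C.span B"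
proof -
  obtain F where F: "finite F"
    "\<And>x. \<forall>z\<in>F. cinner z x = 0 \<Longrightarrow> norm (Q x) \<le> norm Q / 2 * norm x"
    using finite_rank_approx[of "norm Q / 2"] norm_Q_pos by auto
  show ?thesis
  proof (rule subspace_finite_span[OF F(1) subspace_top_eigenspace])
    fix x assume "x \<in> top_eigenspace" "\<forall>z\<in>F. cinner z x = 0"
    then have "norm Q * norm x \<le> norm Q * norm x / 2"
      using F(2)[of x] by (simp add: top_eigenspace_def)
    then have "norm Q * norm x \<le> 0" by argo
    then show "x = 0" using norm_Q_pos by (simp add: mult_le_0_iff)
  qed
qed

end

section \<open>Invariant subspaces of representations of compact groups\<close>

definition ketbra :: "'h::chilbert_space \<Rightarrow> 'h \<Rightarrow> 'h \<Rightarrow>\<^sub>L 'h" where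
  "ketbra z y = Blinfun (\<lambda>x. cinner y x *\<^sub>C z)"

lemma ketbra_apply [simp]: "ketbra z y x = cinner y x *\<^sub>C z"
proof -
  have "bounded_linear (\<lambda>x. cinner y x *\<^sub>C z)"
    using bounded_linear_compose[OF bounded_bilinear.bounded_linear_left[OF bounded_bilinear_scaleC]
        bounded_bilinear.bounded_linear_right[OF bounded_bilinear_cinner]] .
  then show ?thesis by (simp add: ketbra_def bounded_linear_Blinfun_apply)
qed

lemma bounded_bilinear_ketbra: "bounded_bilinear ketbra"
proof
  show "\<exists>K. \<forall>a b. norm (ketbra a b :: 'a \<Rightarrow>\<^sub>L 'a) \<le> norm a * norm b * K"
  proof (intro exI allI norm_blinfun_bound)
    fix a b x :: 'a
    have "cmod (cinner b x) * norm a \<le> (norm b * norm x) * norm a"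
      by (intro mult_right_mono norm_cinner_le) simp
    then show "norm (ketbra a b x) \<le> norm a * norm b * 1 * norm x"
      by (simp add: norm_scaleC mult_ac)
  qed simp
qed (auto intro!: blinfun_eqI simp: blinfun.add_left blinfun.scaleR_left cinner_add_left
      cinner_scaleC_left C.scale_left_distrib C.scale_right_distrib
      scaleC_of_real[symmetric] scaleR_conv_of_real mult.commute)

text \<open>Common setting for the finite groups and the compact Lie groups of the theorem.\<close>

locale compact_unitary_rep =
  fixes G :: "('g, 'm) monoid_scheme" (structure)
    and T :: "'g topology"
    and U :: "'g \<Rightarrow> 'h::chilbert_space \<Rightarrow> 'h"
  assumes group: "group G"
    and compact_space: "compact_space T"
    and topspace: "topspace T = carrier G"
    and rep: "unitary_rep G T U"
begin

interpretation group G by (rule group)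

lemma unitary_U: "g \<in> carrier G \<Longrightarrow> unitary (U g)"
  using rep by (simp add: unitary_rep_def)

lemma U_add: "g \<in> carrier G \<Longrightarrow> U g (x + y) = U g x + U g y"
  using unitary_U[of g] by (simp add: unitary_def Vector_Spaces.linear_iff)

lemma U_scale: "g \<in> carrier G \<Longrightarrow> U g (a *\<^sub>C x) = a *\<^sub>C U g x"
  using unitary_U[of g] by (simp add: unitary_def Vector_Spaces.linear_iff)

lemma U_cinner: "g \<in> carrier G \<Longrightarrow> cinner (U g x) (U g y) = cinner x y"
  using unitary_U[of g] by (simp add: unitary_def)

lemma U_norm: "g \<in> carrier G \<Longrightarrow> norm (U g x) = norm x"
  using U_cinner[of g x x] norm_sq_cinner[of x] norm_sq_cinner[of "U g x"]
  by (metis norm_ge_zero power2_eq_imp_eq)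

lemma U_mult: "g \<in> carrier G \<Longrightarrow> h \<in> carrier G \<Longrightarrow> U g (U h x) = U (g \<otimes> h) x"
  using rep by (simp add: unitary_rep_def)

lemma U_one: "U \<one> x = x"
proof -
  have "surj (U \<one>)" using unitary_U[of \<one>] by (simp add: unitary_def)
  then obtain y where "x = U \<one> y" by blast
  then show ?thesis using U_mult[of \<one> \<one> y] by simp
qed

lemma U_inv_left: "g \<in> carrier G \<Longrightarrow> U (inv g) (U g x) = x"
  by (simp add: U_mult U_one)

lemma U_inv_right: "g \<in> carrier G \<Longrightarrow> U g (U (inv g) x) = x"
  by (simp add: U_mult U_one)

lemma cinner_U_left: "g \<in> carrier G \<Longrightarrow> cinner (U g x) y = cinner x (U (inv g) y)"
  using U_cinner[of g x "U (inv g) y"] by (simp add: U_inv_right)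

lemma bounded_linear_U: "g \<in> carrier G \<Longrightarrow> bounded_linear (U g)"
proof
  assume g: "g \<in> carrier G"
  then show "U g (r *\<^sub>R x) = r *\<^sub>R U g x" for r x
    by (simp add: U_scale flip: scaleC_of_real)
  from g show "\<exists>K. \<forall>x. norm (U g x) \<le> norm x * K"
    by (intro exI[of _ 1]) (simp add: U_norm)
qed (simp add: U_add)

lemma U_zero: "g \<in> carrier G \<Longrightarrow> U g 0 = 0"
  using U_norm[of g 0] by simp

lemma tendsto_U: "g \<in> carrier G \<Longrightarrow> s \<longlonglongrightarrow> x \<Longrightarrow> (\<lambda>n. U g (s n)) \<longlonglongrightarrow> U g x"
  by (rule bounded_linear.tendsto[OF bounded_linear_U])

section \<open>Orbits and invariant subspaces\<close>

definition orbit :: "'h \<Rightarrow> 'h set" where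
  "orbit y = (\<lambda>g. U g y) ` carrier G"

lemma compact_orbit: "compact (orbit y)"
proof -
  have "continuous_map T euclidean (\<lambda>g. U g y)" using rep by (simp add: unitary_rep_def)
  moreover have "compactin T (carrier G)"
    using compact_space topspace by (simp add: compact_space_def)
  ultimately have "compactin euclidean ((\<lambda>g. U g y) ` carrier G)"
    by (rule image_compactin[rotated])
  then show ?thesis by (simp add: orbit_def)
qed

lemma U_orbit: "g \<in> carrier G \<Longrightarrow> z \<in> orbit y \<Longrightarrow> U g z \<in> orbit y"
  by (auto simp: orbit_def U_mult)

lemma self_in_orbit: "y \<in> orbit y"
  unfolding orbit_def by (rule image_eqI[of _ _ \<one>]) (simp_all add: U_one)

lemma norm_orbit: "z \<in> orbit y \<Longrightarrow> norm z = norm y"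
  by (auto simp: orbit_def U_norm)

definition invariant :: "'h set \<Rightarrow> bool" where
  "invariant M \<longleftrightarrow> (\<forall>g\<in>carrier G. \<forall>x\<in>M. U g x \<in> M)"

lemma invariantD: "invariant M \<Longrightarrow> g \<in> carrier G \<Longrightarrow> x \<in> M \<Longrightarrow> U g x \<in> M"
  by (simp add: invariant_def)

lemma invariant_orthogonal:
  assumes "invariant M"
  shows "invariant {x. \<forall>m\<in>M. cinner m x = 0}"
  unfolding invariant_def
proof safe
  fix g x m assume g: "g \<in> carrier G" and x: "\<forall>m\<in>M. cinner m x = 0" and m: "m \<in> M"
  have "U (inv g) m \<in> M" using assms g m by (simp add: invariantD)
  then show "cinner m (U g x) = 0"
    using x cinner_U_left[of "inv g" m x] g by simp
qed

text \<open>Acting on the type of bounded operators, conjugation becomes a linear isometry of a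
  Banach space, as the fixed point lemma requires. \<open>Blinfun (U g)\<close> is meaningful for
  \<open>g\<close> in the carrier, where \<open>U g\<close> is bounded and linear.\<close>

definition conj_U :: "'g \<Rightarrow> ('h \<Rightarrow>\<^sub>L 'h) \<Rightarrow> 'h \<Rightarrow>\<^sub>L 'h" where
  "conj_U g A = Blinfun (U g) o\<^sub>L A o\<^sub>L Blinfun (U (inv g))"

lemma conj_U_apply: "g \<in> carrier G \<Longrightarrow> conj_U g A x = U g (A (U (inv g) x))"
  by (simp add: conj_U_def bounded_linear_Blinfun_apply bounded_linear_U)

lemma conj_U_conj_U: "g \<in> carrier G \<Longrightarrow> conj_U g (conj_U (inv g) A) = A"
  by (rule blinfun_eqI) (simp add: conj_U_apply U_inv_right)

lemma linear_conj_U: "g \<in> carrier G \<Longrightarrow> linear (conj_U g)"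
  by (rule linearI; rule blinfun_eqI)
     (simp_all add: conj_U_apply blinfun.add_left blinfun.scaleR_left U_add
       linear_scale[OF bounded_linear.linear[OF bounded_linear_U]])

lemma norm_conj_U_le: "g \<in> carrier G \<Longrightarrow> norm (conj_U g A) \<le> norm A"
proof (rule norm_blinfun_bound)
  fix x assume g: "g \<in> carrier G"
  show "norm (conj_U g A x) \<le> norm A * norm x"
    using norm_blinfun[of A "U (inv g) x"] g by (simp add: conj_U_apply U_norm)
qed simp

lemma norm_conj_U: "g \<in> carrier G \<Longrightarrow> norm (conj_U g A) = norm A"
  using norm_conj_U_le[of g A] norm_conj_U_le[of "inv g" "conj_U g A"] conj_U_conj_U[of "inv g" A]
  by simp

lemma conj_U_ketbra: "g \<in> carrier G \<Longrightarrow> conj_U g (ketbra z z) = ketbra (U g z) (U g z)"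
  by (rule blinfun_eqI) (simp add: conj_U_apply U_scale cinner_U_left)

text \<open>Being fixed under conjugation means commuting with the representation. The fixed point
  \<open>Q\<close> lies in the closed convex hull \<open>K\<close> of the operators
  \<open>ketbra z z\<close> with \<open>z\<close> in the orbit of \<open>y\<close>, and inherits the
  other properties from them.\<close>

lemma exists_compact_symmetric_intertwiner:
  assumes Y: "C.subspace Y" "closed Y" "invariant Y" and y: "y \<in> Y" "y \<noteq> 0"
  obtains Q where "compact_symmetric Q" "\<And>x. Q x \<in> Y"
    "\<And>g x. g \<in> carrier G \<Longrightarrow> Q (U g x) = U g (Q x)"
proof -
  let ?S = "(\<lambda>z. ketbra z z) ` orbit y"
  define K where "K = closure (convex hull ?S)"
  have "continuous_on (orbit y) (\<lambda>z. ketbra z z)"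
    by (intro bounded_bilinear.continuous_on[OF bounded_bilinear_ketbra] continuous_intros)
  then have "compact ?S" using compact_orbit compact_continuous_image by blast
  then have K: "compact K" unfolding K_def by (rule compact_closure_convex_hull)
  have SK: "?S \<subseteq> K" unfolding K_def using closure_subset hull_subset by (metis subset_trans)
  \<comment> \<open>The transfer principle for \<open>Q\<close>: a closed convex condition on
    operators holds on \<open>K\<close> as soon as it holds for the rank-one generators.\<close>
  have K_sub: "K \<subseteq> X" if "?S \<subseteq> X" "closed X" "convex X" for X
    unfolding K_def by (rule closure_convex_hull_subset[OF that])
  have convK: "convex K" by (simp add: K_def convex_closure)
  have mapsK: "conj_U g ` K \<subseteq> K" if g: "g \<in> carrier G" for g
  proof -
    have "K \<subseteq> conj_U g -` K"
    proof (rule K_sub)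
      have "conj_U g (ketbra z z) \<in> ?S" if "z \<in> orbit y" for z
        unfolding conj_U_ketbra[OF g] using U_orbit[OF g that] by (rule imageI)
      then show "?S \<subseteq> conj_U g -` K" using SK by blast
      have "continuous_on UNIV (conj_U g)"
        using g linear_conj_U norm_conj_U
        by (intro linear_continuous_on) (auto simp: bounded_linear_def bounded_linear_axioms_def intro: exI[of _ 1])
      then show "closed (conj_U g -` K)" using K compact_imp_closed continuous_closed_vimage
        by (metis continuous_on_closed_vimage closed_UNIV inf_top.right_neutral)
      show "convex (conj_U g -` K)" using convK linear_conj_U[OF g] by (rule convex_linear_vimage[rotated])
    qed
    then show ?thesis by blast
  qed
  have "\<exists>Q\<in>K. \<forall>g\<in>carrier G. conj_U g Q = Q"
  proof (rule common_fixed_point_isometries[OF K convK])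
    show "K \<noteq> {}" using SK self_in_orbit by blast
    show "conj_U g ` K \<subseteq> K" if "g \<in> carrier G" for g using mapsK[OF that] .
    show "linear (conj_U g)" if "g \<in> carrier G" for g using linear_conj_U[OF that] .
    show "norm (conj_U g A) = norm A" if "g \<in> carrier G" for g A using norm_conj_U[OF that] .
    show "\<exists>h\<in>carrier G. \<forall>A. conj_U g (conj_U h A) = A" if "g \<in> carrier G" for g
      using that conj_U_conj_U inv_closed by blast
  qed blast
  then obtain Q where QK: "Q \<in> K" and fix_Q: "\<And>g. g \<in> carrier G \<Longrightarrow> conj_U g Q = Q"
    by blast
  have commute: "Q (U g x) = U g (Q x)" if "g \<in> carrier G" for g x
    using fix_Q[OF that] conj_U_apply[OF that, of Q "U g x"] that by (simp add: U_inv_left)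
  have orbitY: "orbit y \<subseteq> Y" using Y y by (auto simp: orbit_def invariantD)
  have range: "Q x \<in> Y" for x
  proof -
    have "K \<subseteq> {A. blinfun_apply A x \<in> Y}"
    proof (rule K_sub)
      show "?S \<subseteq> {A. blinfun_apply A x \<in> Y}" using orbitY Y by (auto simp: C.subspace_scale)
      have "{A. blinfun_apply A x \<in> Y} = (\<lambda>A. blinfun_apply A x) -` Y" by auto
      then show "closed {A. blinfun_apply A x \<in> Y}" using Y
        by (auto intro!: closed_vimage continuous_intros)
      show "convex {A. blinfun_apply A x \<in> Y}" using subspace_imp_convex[OF C_subspace_imp_subspace[OF Y(1)]]
        by (auto simp: convex_def blinfun.add_left blinfun.scaleR_left)
    qed
    with QK show ?thesis by blast
  qed
  have "compact_symmetric Q"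
  proof
    fix a x z
    have "K \<subseteq> {A. blinfun_apply A (a *\<^sub>C x) = a *\<^sub>C blinfun_apply A x}"
    proof (rule K_sub)
      show "?S \<subseteq> {A. blinfun_apply A (a *\<^sub>C x) = a *\<^sub>C blinfun_apply A x}"
        by (auto simp: cinner_scaleC_right)
      show "closed {A. blinfun_apply A (a *\<^sub>C x) = a *\<^sub>C blinfun_apply A x}"
        by (intro closed_Collect_eq continuous_intros)
      show "convex {A. blinfun_apply A (a *\<^sub>C x) = a *\<^sub>C blinfun_apply A x}"
        by (auto simp: convex_def blinfun.add_left blinfun.scaleR_left C.scale_right_distrib
            mult.commute simp flip: scaleC_of_real)
    qed
    with QK show "Q (a *\<^sub>C x) = a *\<^sub>C Q x" by blast
    have "K \<subseteq> {A. cinner (blinfun_apply A x) z = cinner x (blinfun_apply A z)}"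
    proof (rule K_sub)
      show "?S \<subseteq> {A. cinner (blinfun_apply A x) z = cinner x (blinfun_apply A z)}"
        by (auto simp: cinner_scaleC_left cinner_scaleC_right cinner_commute[symmetric])
      show "closed {A. cinner (blinfun_apply A x) z = cinner x (blinfun_apply A z)}"
        by (intro closed_Collect_eq continuous_intros)
      show "convex {A. cinner (blinfun_apply A x) z = cinner x (blinfun_apply A z)}"
        by (auto simp: convex_def blinfun.add_left blinfun.scaleR_left cinner_add_left
            cinner_add_right cinner_scaleR_left cinner_scaleR_right)
    qed
    with QK show "cinner (Q x) z = cinner x (Q z)" by blast
  next
    \<comment> \<open>On the unit ball a generator takes values \<open>a *\<^sub>C z\<close> with
      \<open>cmod a \<le> norm y\<close> and \<open>z\<close> in the orbit. Hence a single compact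
      convex set \<open>D\<close> contains the image of the ball under every operator in
      \<open>K\<close>.\<close>
    let ?P = "(\<lambda>(a, z). a *\<^sub>C z) ` (cball 0 (norm y) \<times> orbit y)"
    define D where "D = closure (convex hull ?P)"
    have "compact ?P"
      by (intro compact_continuous_image compact_Times compact_cball compact_orbit)
         (simp add: case_prod_unfold, intro continuous_intros)
    then have D: "compact D" unfolding D_def by (rule compact_closure_convex_hull)
    have PD: "?P \<subseteq> D" unfolding D_def using closure_subset hull_subset by (metis subset_trans)
    have "Q x \<in> D" if x: "x \<in> cball 0 1" for x
    proof -
      have "K \<subseteq> {A. blinfun_apply A x \<in> D}"
      proof (rule K_sub)
        have "ketbra z z x \<in> D" if z: "z \<in> orbit y" for z
        proof -
          have "cmod (cinner z x) \<le> norm z * norm x" by (rule norm_cinner_le)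
          also have "\<dots> \<le> norm y" using x norm_orbit[OF z] by (simp add: mult_left_le)
          finally have "(cinner z x, z) \<in> cball 0 (norm y) \<times> orbit y" using z by simp
          then have "(\<lambda>(a, z). a *\<^sub>C z) (cinner z x, z) \<in> D" using PD by blast
          then show ?thesis by simp
        qed
        then show "?S \<subseteq> {A. blinfun_apply A x \<in> D}" by auto
        have "{A. blinfun_apply A x \<in> D} = (\<lambda>A. blinfun_apply A x) -` D" by auto
        then show "closed {A. blinfun_apply A x \<in> D}" using compact_imp_closed[OF D]
          by (auto intro!: closed_vimage continuous_intros)
        have "convex D" by (simp add: D_def convex_closure)
        then show "convex {A. blinfun_apply A x \<in> D}"
          by (auto simp: convex_def blinfun.add_left blinfun.scaleR_left)
      qed
      with QK show ?thesis by blast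
    qed
    then have "closure (Q ` cball 0 1) \<subseteq> D" using D
      by (intro closure_minimal compact_imp_closed) auto
    then show "compact (closure (Q ` cball 0 1))"
      using compact_Int_closed[OF D closed_closure] by (metis inf.absorb2)
  next
    fix e :: real assume "e > 0"
    then obtain A where A: "A \<in> convex hull ?S" "dist A Q < e"
      using QK unfolding K_def closure_approachable by blast
    \<comment> \<open>Operators vanishing on the complement of a finite set form a convex set, but
      not in general a closed one. So the condition is transferred to the convex hull only, and
      \<open>Q\<close> is approximated by an element \<open>A\<close> of it.\<close>
    let ?X = "{A :: 'h \<Rightarrow>\<^sub>L 'h. \<exists>F. finite F \<and> (\<forall>x. (\<forall>z\<in>F. cinner z x = 0) \<longrightarrow> A x = 0)}"
    have "convex hull ?S \<subseteq> ?X"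
    proof (rule hull_minimal)
      show "?S \<subseteq> ?X"
      proof safe
        fix z
        show "\<exists>F. finite F \<and> (\<forall>x. (\<forall>z\<in>F. cinner z x = 0) \<longrightarrow> ketbra z z x = 0)"
          by (rule exI[of _ "{z}"]) simp
      qed
      show "convex ?X"
      proof (rule convexI)
        fix A B :: "'h \<Rightarrow>\<^sub>L 'h" and u v :: real assume "A \<in> ?X" "B \<in> ?X"
        then obtain F F' where F: "finite F" "\<And>x. \<forall>z\<in>F. cinner z x = 0 \<Longrightarrow> A x = 0"
          "finite F'" "\<And>x. \<forall>z\<in>F'. cinner z x = 0 \<Longrightarrow> B x = 0" by auto
        then have "finite (F \<union> F') \<and>
            (\<forall>x. (\<forall>z\<in>F \<union> F'. cinner z x = 0) \<longrightarrow> (u *\<^sub>R A + v *\<^sub>R B) x = 0)"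
          by (simp add: blinfun.add_left blinfun.scaleR_left)
        then show "u *\<^sub>R A + v *\<^sub>R B \<in> ?X" by blast
      qed
    qed
    with A obtain F where F: "finite F" "\<And>x. \<forall>z\<in>F. cinner z x = 0 \<Longrightarrow> A x = 0" by blast
    have "norm (Q x) \<le> e * norm x" if "\<forall>z\<in>F. cinner z x = 0" for x
    proof -
      have "norm (Q x) = norm ((A - Q) x)" using F(2)[OF that] by (simp add: blinfun.diff_left)
      also have "\<dots> \<le> norm (A - Q) * norm x" by (rule norm_blinfun)
      also have "\<dots> \<le> e * norm x" using A by (intro mult_right_mono) (auto simp: dist_norm)
      finally show ?thesis .
    qed
    with F show "\<exists>F. finite F \<and> (\<forall>x. (\<forall>z\<in>F. cinner z x = 0) \<longrightarrow> norm (Q x) \<le> e * norm x)" by blast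
  next
    \<comment> \<open>Two vectors of norm \<open>norm y\<close> at distance at most
      \<open>norm y\<close> have an inner product of real part at least \<open>e\<close>. Hence on
      every generator the partial trace over the net \<open>F\<close> is at least
      \<open>e\<^sup>2\<close>; this closed convex condition excludes the zero operator.\<close>
    define e where "e = (norm y)\<^sup>2 / 2"
    have e: "e > 0" using y by (simp add: e_def)
    obtain F where F: "finite F" "F \<subseteq> orbit y" and net: "orbit y \<subseteq> (\<Union>x\<in>F. ball x (norm y))"
      using compact_imp_finite_net[OF compact_orbit, of "norm y" y] y by auto
    let ?X = "{A :: 'h \<Rightarrow>\<^sub>L 'h. e\<^sup>2 \<le> (\<Sum>f\<in>F. Re (cinner f (A f)))}"
    have "K \<subseteq> ?X"
    proof (rule K_sub)
      show "?S \<subseteq> ?X"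
      proof safe
        fix z assume z: "z \<in> orbit y"
        then obtain f where f: "f \<in> F" "dist f z < norm y" using net by auto
        have "(norm (f - z))\<^sup>2 \<le> (norm y)\<^sup>2" using f by (intro power_mono) (auto simp: dist_norm)
        then have "e \<le> Re (cinner f z)"
          using norm_diff_sq[of f z] norm_orbit z f F by (auto simp: e_def)
        also have "\<dots> \<le> cmod (cinner f z)" by (rule complex_Re_le_cmod)
        finally have "e\<^sup>2 \<le> (cmod (cinner f z))\<^sup>2" using e by (simp add: power_mono)
        also have "\<dots> \<le> (\<Sum>f\<in>F. (cmod (cinner f z))\<^sup>2)"
          using f F by (intro member_le_sum) auto
        also have "\<dots> = (\<Sum>f\<in>F. Re (cinner f (ketbra z z f)))"
        proof (rule sum.cong)
          fix f
          have "Re (cinner z f * cinner f z) = (cmod (cinner f z))\<^sup>2"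
            by (subst cinner_commute[of z f])
               (metis Re_complex_of_real complex_norm_square mult.commute)
          then show "(cmod (cinner f z))\<^sup>2 = Re (cinner f (ketbra z z f))"
            by (simp add: cinner_scaleC_right)
        qed simp
        finally show "e\<^sup>2 \<le> (\<Sum>f\<in>F. Re (cinner f (ketbra z z f)))" .
      qed
      show "closed ?X" by (intro closed_Collect_le continuous_intros)
      show "convex ?X"
      proof (rule convexI)
        fix A B :: "'h \<Rightarrow>\<^sub>L 'h" and u v :: real
        assume AB: "A \<in> ?X" "B \<in> ?X" and uv: "0 \<le> u" "0 \<le> v" "u + v = 1"
        have "e\<^sup>2 = u * e\<^sup>2 + v * e\<^sup>2" using uv by (simp flip: distrib_right)
        also have "\<dots> \<le> u * (\<Sum>f\<in>F. Re (cinner f (A f))) + v * (\<Sum>f\<in>F. Re (cinner f (B f)))"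
          using AB uv by (intro add_mono mult_left_mono) auto
        also have "\<dots> = (\<Sum>f\<in>F. Re (cinner f ((u *\<^sub>R A + v *\<^sub>R B) f)))"
          by (simp add: blinfun.add_left blinfun.scaleR_left cinner_add_right cinner_scaleR_right
              sum.distrib sum_distrib_left)
        finally show "u *\<^sub>R A + v *\<^sub>R B \<in> ?X" by simp
      qed
    qed
    then have "e\<^sup>2 \<le> (\<Sum>f\<in>F. Re (cinner f (Q f)))" using QK by blast
    then show "Q \<noteq> 0" using e by auto
  qed
  with range commute that show thesis by blast
qed

text \<open>The top eigenspace of an intertwiner \<open>Q\<close> with values in \<open>Y\<close>
  serves: it is invariant because \<open>Q\<close> commutes with the norm-preserving
  \<open>U g\<close>, and it lies in \<open>Y\<close> because each of its vectors is a multiple of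
  \<open>Q (Q x)\<close>.\<close>

lemma exists_finite_invariant_subspace:
  assumes Y: "C.subspace Y" "closed Y" "invariant Y" and y: "y \<in> Y" "y \<noteq> 0"
  obtains E B where "C.subspace E" "E \<subseteq> Y" "invariant E" "\<exists>x\<in>E. x \<noteq> 0"
    "finite B" "B \<subseteq> E" "E \<subseteq> C.span B" "compact (E \<inter> sphere 0 1)"
proof -
  obtain Q where "compact_symmetric Q" and range: "\<And>x. Q x \<in> Y"
    and commute: "\<And>g x. g \<in> carrier G \<Longrightarrow> Q (U g x) = U g (Q x)"
    using exists_compact_symmetric_intertwiner[OF assms] by blast
  interpret compact_symmetric Q by fact
  have "top_eigenspace \<subseteq> Y"
  proof
    fix x assume x: "x \<in> top_eigenspace"
    have "x = (1 / (norm Q)\<^sup>2) *\<^sub>R Q (Q x)" using Q_Q_top_eigenspace[OF x] norm_Q_pos by simp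
    then show "x \<in> Y" using range C_subspace_imp_subspace[OF Y(1)] by (metis subspace_scale)
  qed
  moreover have "invariant top_eigenspace"
    by (auto simp: invariant_def top_eigenspace_def commute U_norm)
  ultimately show thesis
    using that subspace_top_eigenspace top_eigenspace_nontrivial finite_span_top_eigenspace
      compact_sphere_top_eigenspace by blast
qed

end

text \<open>Two nontrivial solutions of the equations in \<open>I\<close> with disjoint supports can
  be combined so that the new equation \<open>j\<close> holds too. The lower bound \<open>m\<close>
  on the support makes the induction provide disjoint supports.\<close>

lemma exists_nontrivial_coefficients:
  fixes f :: "'i \<Rightarrow> nat \<Rightarrow> complex"
  assumes "finite I"
  shows "\<exists>K c. finite K \<and> K \<subseteq> {m..} \<and> (\<exists>k\<in>K. c k \<noteq> 0) \<and> (\<forall>i\<in>I. (\<Sum>k\<in>K. c k * f i k) = 0)"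
  using assms
proof (induction I arbitrary: m)
  case empty
  show ?case by (rule exI[of _ "{m}"], rule exI[of _ "\<lambda>_. 1"]) simp
next
  case (insert j I)
  obtain K c where K: "finite K" "K \<subseteq> {m..}" "\<exists>k\<in>K. c k \<noteq> 0"
    and Kf: "\<And>i. i \<in> I \<Longrightarrow> (\<Sum>k\<in>K. c k * f i k) = 0"
    using insert.IH[of m] by blast
  show ?case
  proof (cases "(\<Sum>k\<in>K. c k * f j k) = 0")
    case True
    with K Kf show ?thesis by (metis insert_iff)
  next
    case False
    \<comment> \<open>Starting above the maximum of \<open>K\<close> makes the supports disjoint;
      inserting \<open>m\<close> also keeps the new support above \<open>m\<close>.\<close>
    obtain K' c' where K': "finite K'" "K' \<subseteq> {Suc (Max (insert m K))..}" "\<exists>k\<in>K'. c' k \<noteq> 0"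
      and Kf': "\<And>i. i \<in> I \<Longrightarrow> (\<Sum>k\<in>K'. c' k * f i k) = 0"
      using insert.IH[of "Suc (Max (insert m K))"] by blast
    have above: "m \<le> k \<and> k \<notin> K" if "k \<in> K'" for k
    proof -
      have "Max (insert m K) < k" using K' that by auto
      then show ?thesis using K(1) by auto
    qed
    then have disj: "K \<inter> K' = {}" by blast
    define s where "s = (\<Sum>k\<in>K. c k * f j k)"
    define s' where "s' = (\<Sum>k\<in>K'. c' k * f j k)"
    \<comment> \<open>The factors \<open>s'\<close> and \<open>- s\<close> cancel the two
      contributions to equation \<open>j\<close>. The combination is nontrivial on
      \<open>K'\<close>, since \<open>s\<close> is nonzero in this case.\<close>
    define d where "d k = (if k \<in> K then s' * c k else - s * c' k)" for k
    have d: "(\<Sum>k\<in>K \<union> K'. d k * f i k) = s' * (\<Sum>k\<in>K. c k * f i k) - s * (\<Sum>k\<in>K'. c' k * f i k)" for i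
    proof -
      have "(\<Sum>k\<in>K \<union> K'. d k * f i k) = (\<Sum>k\<in>K. d k * f i k) + (\<Sum>k\<in>K'. d k * f i k)"
        using K K' disj by (intro sum.union_disjoint) auto
      also have "(\<Sum>k\<in>K. d k * f i k) = s' * (\<Sum>k\<in>K. c k * f i k)"
        by (simp add: d_def sum_distrib_left mult.assoc)
      also have "(\<Sum>k\<in>K'. d k * f i k) = (\<Sum>k\<in>K'. - s * (c' k * f i k))"
        using above by (intro sum.cong) (auto simp: d_def)
      finally show ?thesis by (simp add: sum_distrib_left sum_negf)
    qed
    have "(\<Sum>k\<in>K \<union> K'. d k * f i k) = 0" if "i \<in> insert j I" for i
      using that Kf Kf' unfolding d by (auto simp: s_def s'_def)
    moreover have "\<exists>k\<in>K \<union> K'. d k \<noteq> 0"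
    proof -
      obtain k where "k \<in> K'" "c' k \<noteq> 0" using K' by blast
      then show ?thesis using above False by (intro bexI[of _ k]) (auto simp: d_def s_def)
    qed
    moreover have "K \<union> K' \<subseteq> {m..}" using K above by auto
    ultimately show ?thesis using K K' by (intro exI[of _ "K \<union> K'"] exI[of _ d]) auto
  qed
qed

context compact_unitary_rep
begin

interpretation group G by (rule group)

section \<open>Isometric intertwiners between subspaces\<close>

text \<open>With partial intertwiners encoded as relations, inverses, compositions, closures and
  unions of chains are plain set operations. The norm condition makes both the relation and its
  converse single-valued.\<close>

definition isometric_graph :: "('h \<times> 'h) set \<Rightarrow> bool" where
  "isometric_graph \<Gamma> \<longleftrightarrow> (0, 0) \<in> \<Gamma> \<and>
     (\<forall>a b c d. (a, b) \<in> \<Gamma> \<longrightarrow> (c, d) \<in> \<Gamma> \<longrightarrow> (a + c, b + d) \<in> \<Gamma>) \<and>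
     (\<forall>t a b. (a, b) \<in> \<Gamma> \<longrightarrow> (t *\<^sub>C a, t *\<^sub>C b) \<in> \<Gamma>) \<and>
     (\<forall>a b. (a, b) \<in> \<Gamma> \<longrightarrow> norm a = norm b) \<and>
     (\<forall>g a b. g \<in> carrier G \<longrightarrow> (a, b) \<in> \<Gamma> \<longrightarrow> (U g a, U g b) \<in> \<Gamma>)"

lemma isometric_graphD:
  assumes "isometric_graph \<Gamma>"
  shows "(0, 0) \<in> \<Gamma>"
    and "(a, b) \<in> \<Gamma> \<Longrightarrow> (c, d) \<in> \<Gamma> \<Longrightarrow> (a + c, b + d) \<in> \<Gamma>"
    and "(a, b) \<in> \<Gamma> \<Longrightarrow> (t *\<^sub>C a, t *\<^sub>C b) \<in> \<Gamma>"
    and "(a, b) \<in> \<Gamma> \<Longrightarrow> norm a = norm b"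
    and "g \<in> carrier G \<Longrightarrow> (a, b) \<in> \<Gamma> \<Longrightarrow> (U g a, U g b) \<in> \<Gamma>"
  using assms unfolding isometric_graph_def by metis+

lemma isometric_graph_diff:
  assumes "isometric_graph \<Gamma>" "(a, b) \<in> \<Gamma>" "(c, d) \<in> \<Gamma>"
  shows "(a - c, b - d) \<in> \<Gamma>"
  using isometric_graphD(2)[OF assms(1,2) isometric_graphD(3)[OF assms(1,3), of "-1"]] by simp

lemma isometric_graph_unique:
  assumes "isometric_graph \<Gamma>" "(a, b) \<in> \<Gamma>" "(a, d) \<in> \<Gamma>"
  shows "b = d"
  using isometric_graphD(4)[OF assms(1) isometric_graph_diff[OF assms]] by simp

lemma isometric_graph_cinner:
  assumes "isometric_graph \<Gamma>" "(a, b) \<in> \<Gamma>" "(c, d) \<in> \<Gamma>"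
  shows "cinner a c = cinner b d"
  by (rule cinner_eq_if_norm_eq, rule isometric_graphD(4)[OF assms(1)])
     (intro isometric_graphD(2,3)[OF assms(1)] assms)

lemma isometric_graph_converse:
  assumes "isometric_graph \<Gamma>"
  shows "isometric_graph (\<Gamma>\<inverse>)"
  unfolding isometric_graph_def converse_iff
  using isometric_graphD[OF assms] by metis

lemma isometric_graph_Id: "isometric_graph Id"
  by (simp add: isometric_graph_def)

lemma isometric_graph_relcomp:
  assumes \<Gamma>: "isometric_graph \<Gamma>" and \<Delta>: "isometric_graph \<Delta>"
  shows "isometric_graph (\<Gamma> O \<Delta>)"
  unfolding isometric_graph_def
proof (intro conjI allI impI)
  show "(0, 0) \<in> \<Gamma> O \<Delta>"
    using isometric_graphD(1)[OF \<Gamma>] isometric_graphD(1)[OF \<Delta>] by (rule relcompI)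
  show "norm a = norm b" if "(a, b) \<in> \<Gamma> O \<Delta>" for a b
    using that isometric_graphD(4)[OF \<Gamma>] isometric_graphD(4)[OF \<Delta>] by force
  show "(a + c, b + d) \<in> \<Gamma> O \<Delta>" if "(a, b) \<in> \<Gamma> O \<Delta>" "(c, d) \<in> \<Gamma> O \<Delta>" for a b c d
    using that isometric_graphD(2)[OF \<Gamma>] isometric_graphD(2)[OF \<Delta>] by blast
  show "(t *\<^sub>C a, t *\<^sub>C b) \<in> \<Gamma> O \<Delta>" if "(a, b) \<in> \<Gamma> O \<Delta>" for t a b
    using that isometric_graphD(3)[OF \<Gamma>] isometric_graphD(3)[OF \<Delta>] by blast
  show "(U g a, U g b) \<in> \<Gamma> O \<Delta>" if "g \<in> carrier G" "(a, b) \<in> \<Gamma> O \<Delta>" for g a b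
    using that isometric_graphD(5)[OF \<Gamma>] isometric_graphD(5)[OF \<Delta>] by blast
qed

lemma isometric_graph_relpow: "isometric_graph \<Gamma> \<Longrightarrow> isometric_graph (\<Gamma> ^^ k)"
  by (induction k) (simp_all add: isometric_graph_Id isometric_graph_relcomp)

lemma isometric_graph_closure:
  assumes \<Gamma>: "isometric_graph \<Gamma>"
  shows "isometric_graph (closure \<Gamma>)"
proof -
  have lim: "\<exists>s t. (\<forall>n. (s n, t n) \<in> \<Gamma>) \<and> s \<longlonglongrightarrow> a \<and> t \<longlonglongrightarrow> b" if "(a, b) \<in> closure \<Gamma>" for a b
  proof -
    from that obtain p where p: "\<And>n. p n \<in> \<Gamma>" "p \<longlonglongrightarrow> (a, b)"
      unfolding closure_sequential by blast
    show ?thesis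
      using p(1) tendsto_fst[OF p(2)] tendsto_snd[OF p(2)]
      by (intro exI[of _ "\<lambda>n. fst (p n)"] exI[of _ "\<lambda>n. snd (p n)"]) simp
  qed
  have closureI: "(a, b) \<in> closure \<Gamma>" if "\<And>n. (s n, t n) \<in> \<Gamma>" "s \<longlonglongrightarrow> a" "t \<longlonglongrightarrow> b" for s t a b
    unfolding closure_sequential using that by (intro exI[of _ "\<lambda>n. (s n, t n)"]) (auto intro: tendsto_Pair)
  show ?thesis
    unfolding isometric_graph_def
  proof (intro conjI allI impI)
    show "(0, 0) \<in> closure \<Gamma>" using isometric_graphD(1)[OF \<Gamma>] closure_subset by blast
    fix a b assume "(a, b) \<in> closure \<Gamma>"
    then obtain s t where st: "\<And>n. (s n, t n) \<in> \<Gamma>" "s \<longlonglongrightarrow> a" "t \<longlonglongrightarrow> b" using lim by blast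
    show "norm a = norm b"
      using tendsto_norm[OF st(2)] tendsto_norm[OF st(3)] isometric_graphD(4)[OF \<Gamma> st(1)]
      by (simp add: LIMSEQ_unique)
    show "(z *\<^sub>C a, z *\<^sub>C b) \<in> closure \<Gamma>" for z
      by (rule closureI[of "\<lambda>n. z *\<^sub>C s n" "\<lambda>n. z *\<^sub>C t n"])
         (intro isometric_graphD(3)[OF \<Gamma>] tendsto_intros st)+
    show "(U g a, U g b) \<in> closure \<Gamma>" if "g \<in> carrier G" for g
      by (rule closureI[of "\<lambda>n. U g (s n)" "\<lambda>n. U g (t n)"])
         (intro isometric_graphD(5)[OF \<Gamma>] tendsto_U that st)+
    fix c d assume "(c, d) \<in> closure \<Gamma>"
    then obtain u v where uv: "\<And>n. (u n, v n) \<in> \<Gamma>" "u \<longlonglongrightarrow> c" "v \<longlonglongrightarrow> d" using lim by blast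
    show "(a + c, b + d) \<in> closure \<Gamma>"
      by (rule closureI[of "\<lambda>n. s n + u n" "\<lambda>n. t n + v n"])
         (intro isometric_graphD(2)[OF \<Gamma>] tendsto_intros st uv)+
  qed
qed

lemma isometric_graph_Range:
  assumes \<Gamma>: "isometric_graph \<Gamma>"
  shows "C.subspace (Range \<Gamma>)" "invariant (Range \<Gamma>)"
    and "closed \<Gamma> \<Longrightarrow> closed (Range \<Gamma>)"
proof -
  show "C.subspace (Range \<Gamma>)"
    unfolding C.subspace_def using isometric_graphD(1-3)[OF \<Gamma>] by blast
  show "invariant (Range \<Gamma>)"
    unfolding invariant_def using isometric_graphD(5)[OF \<Gamma>] by blast
  assume "closed \<Gamma>"
  show "closed (Range \<Gamma>)"
    unfolding closed_sequential_limits
  proof (intro allI impI, elim conjE)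
    fix t b assume "\<forall>n. t n \<in> Range \<Gamma>" and t: "t \<longlonglongrightarrow> b"
    then have "\<forall>n. \<exists>a. (a, t n) \<in> \<Gamma>" by (simp add: Range_iff)
    then obtain s where s: "\<And>n. (s n, t n) \<in> \<Gamma>" by metis
    \<comment> \<open>The graph preserves distances, so convergence of the images makes the
      preimages Cauchy.\<close>
    have "dist (s m) (s n) = dist (t m) (t n)" for m n
      unfolding dist_norm by (rule isometric_graphD(4)[OF \<Gamma> isometric_graph_diff[OF \<Gamma> s s]])
    then have "Cauchy s" using LIMSEQ_imp_Cauchy[OF t] by (simp add: Cauchy_def)
    then obtain a where "s \<longlonglongrightarrow> a" using Cauchy_convergent convergent_def by blast
    with t have "(\<lambda>n. (s n, t n)) \<longlonglongrightarrow> (a, b)" by (intro tendsto_Pair)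
    then have "(a, b) \<in> \<Gamma>"
      using closed_sequentially[OF \<open>closed \<Gamma>\<close>, of "\<lambda>n. (s n, t n)"] s by simp
    then show "b \<in> Range \<Gamma>" by blast
  qed
qed

section \<open>Maximal isometric intertwiners\<close>

definition maximal_graph :: "('h \<times> 'h) set \<Rightarrow> bool" where
  "maximal_graph \<Gamma> \<longleftrightarrow> isometric_graph \<Gamma> \<and> (\<forall>\<Delta>. isometric_graph \<Delta> \<longrightarrow> \<Gamma> \<subseteq> \<Delta> \<longrightarrow> \<Delta> = \<Gamma>)"

lemma maximal_graph_closed: "maximal_graph \<Gamma> \<Longrightarrow> closed \<Gamma>"
  unfolding maximal_graph_def
  by (metis closed_closure closure_subset isometric_graph_closure)

lemma maximal_graph_converse:
  assumes "maximal_graph \<Gamma>"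
  shows "maximal_graph (\<Gamma>\<inverse>)"
  unfolding maximal_graph_def
proof (intro conjI allI impI)
  show "isometric_graph (\<Gamma>\<inverse>)" using assms isometric_graph_converse maximal_graph_def by blast
  fix \<Delta> assume "isometric_graph \<Delta>" "\<Gamma>\<inverse> \<subseteq> \<Delta>"
  then have "isometric_graph (\<Delta>\<inverse>)" "\<Gamma> \<subseteq> \<Delta>\<inverse>" using isometric_graph_converse by auto
  then have "\<Delta>\<inverse> = \<Gamma>" using assms by (simp add: maximal_graph_def)
  then show "\<Delta> = \<Gamma>\<inverse>" by (metis converse_converse)
qed

lemma exists_maximal_graph:
  assumes "isometric_graph \<Gamma>"
  obtains \<Delta> where "maximal_graph \<Delta>" "\<Gamma> \<subseteq> \<Delta>"
proof -
  have "\<exists>M\<in>{\<Delta>. isometric_graph \<Delta> \<and> \<Gamma> \<subseteq> \<Delta>}. \<forall>X\<in>{\<Delta>. isometric_graph \<Delta> \<and> \<Gamma> \<subseteq> \<Delta>}. M \<subseteq> X \<longrightarrow> X = M"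
  proof (rule subset_Zorn_nonempty)
    show "{\<Delta>. isometric_graph \<Delta> \<and> \<Gamma> \<subseteq> \<Delta>} \<noteq> {}" using assms by blast
    fix \<C> assume ne: "\<C> \<noteq> {}" and ch: "subset.chain {\<Delta>. isometric_graph \<Delta> \<and> \<Gamma> \<subseteq> \<Delta>} \<C>"
    have g: "isometric_graph \<Delta>" "\<Gamma> \<subseteq> \<Delta>" if "\<Delta> \<in> \<C>" for \<Delta>
      using ch that by (auto simp: subset_chain_def)
    have two: "\<exists>\<Delta>\<in>\<C>. x \<in> \<Delta> \<and> y \<in> \<Delta>" if xy: "x \<in> \<Union>\<C>" "y \<in> \<Union>\<C>" for x y
    proof -
      obtain X Y where XY: "X \<in> \<C>" "x \<in> X" "Y \<in> \<C>" "y \<in> Y" using xy by blast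
      then have "X \<subseteq> Y \<or> Y \<subseteq> X" using ch by (simp add: subset_chain_def)
      then show ?thesis using XY by blast
    qed
    have "isometric_graph (\<Union>\<C>)"
      unfolding isometric_graph_def
    proof (intro conjI allI impI)
      show "(0, 0) \<in> \<Union>\<C>" using ne g(1) isometric_graphD(1) by blast
      show "norm a = norm b" if "(a, b) \<in> \<Union>\<C>" for a b
        using that g(1) isometric_graphD(4) by blast
      show "(t *\<^sub>C a, t *\<^sub>C b) \<in> \<Union>\<C>" if "(a, b) \<in> \<Union>\<C>" for t a b
        using that g(1) isometric_graphD(3) by blast
      show "(U g' a, U g' b) \<in> \<Union>\<C>" if "g' \<in> carrier G" "(a, b) \<in> \<Union>\<C>" for g' a b
        using that g(1) isometric_graphD(5) by blast
      fix a b c d assume "(a, b) \<in> \<Union>\<C>" "(c, d) \<in> \<Union>\<C>"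
      then obtain \<Delta> where "\<Delta> \<in> \<C>" "(a, b) \<in> \<Delta>" "(c, d) \<in> \<Delta>" using two by meson
      then show "(a + c, b + d) \<in> \<Union>\<C>" using g(1) isometric_graphD(2) by blast
    qed
    then show "\<Union>\<C> \<in> {\<Delta>. isometric_graph \<Delta> \<and> \<Gamma> \<subseteq> \<Delta>}" using ne g(2) by blast
  qed
  then obtain \<Delta> where "\<Delta> \<in> {\<Delta>. isometric_graph \<Delta> \<and> \<Gamma> \<subseteq> \<Delta>}"
    and "\<forall>X\<in>{\<Delta>. isometric_graph \<Delta> \<and> \<Gamma> \<subseteq> \<Delta>}. \<Delta> \<subseteq> X \<longrightarrow> X = \<Delta>"
    by (rule bexE)
  then have D: "isometric_graph \<Delta> \<and> \<Gamma> \<subseteq> \<Delta>"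
    and max: "\<forall>X. isometric_graph X \<and> \<Gamma> \<subseteq> X \<longrightarrow> \<Delta> \<subseteq> X \<longrightarrow> X = \<Delta>"
    by simp_all
  have "maximal_graph \<Delta>"
    unfolding maximal_graph_def
  proof (intro conjI allI impI)
    show "isometric_graph \<Delta>" using D ..
    fix X assume X: "isometric_graph X" "\<Delta> \<subseteq> X"
    then have "\<Gamma> \<subseteq> X" using D by (meson order_trans)
    then show "X = \<Delta>" using max X by simp
  qed
  then show thesis by (rule that) (use D in simp)
qed

text \<open>A nonzero intertwiner \<open>A\<close> from \<open>(Range \<Gamma>)\<^sup>\<bottom>\<close> to \<open>(Domain \<Gamma>)\<^sup>\<bottom>\<close> would, after rescaling,
  be isometric on the subspace where it attains its norm, and so extend the graph.\<close>

lemma maximal_graph_intertwiner_zero: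
  assumes max: "maximal_graph \<Gamma>"
    and E: "C.subspace E" "invariant E" "compact (E \<inter> sphere 0 1)"
    and E_orth: "\<And>x b. x \<in> E \<Longrightarrow> b \<in> Range \<Gamma> \<Longrightarrow> cinner b x = 0"
    and A_add: "\<And>x y. x \<in> E \<Longrightarrow> y \<in> E \<Longrightarrow> A (x + y) = A x + A y"
    and A_scale: "\<And>t x. x \<in> E \<Longrightarrow> A (t *\<^sub>C x) = t *\<^sub>C A x"
    and A_U: "\<And>g x. g \<in> carrier G \<Longrightarrow> x \<in> E \<Longrightarrow> A (U g x) = U g (A x)"
    and A_le: "\<And>x. x \<in> E \<Longrightarrow> norm (A x) \<le> norm x"
    and A_orth: "\<And>x a. x \<in> E \<Longrightarrow> a \<in> Domain \<Gamma> \<Longrightarrow> cinner a (A x) = 0"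
    and x0: "x0 \<in> E"
  shows "A x0 = 0"
proof (rule ccontr)
  assume Ax0: "A x0 \<noteq> 0"
  have \<Gamma>: "isometric_graph \<Gamma>" using max by (simp add: maximal_graph_def)
  have "0 \<in> E" using E(1) by (rule C.subspace_0)
  then have A0: "A 0 = 0" using A_scale[of 0 0] by simp
  then have "x0 \<noteq> 0" using Ax0 by blast
  have A_scaleR: "A (r *\<^sub>R x) = r *\<^sub>R A x" "r *\<^sub>R x \<in> E" if "x \<in> E" for r x
    using A_scale[OF that, of "complex_of_real r"] C.subspace_scale[OF E(1) that, of "complex_of_real r"]
    by (simp_all add: scaleC_of_real)
  have A_diff: "A (x - y) = A x - A y" if "x \<in> E" "y \<in> E" for x y
    using A_add[of x "(-1) *\<^sub>R y"] A_scaleR[of y "-1"] that by simp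
  let ?S = "E \<inter> sphere 0 1"
  have "(1 / norm x0) *\<^sub>R x0 \<in> ?S" using x0 \<open>x0 \<noteq> 0\<close> A_scaleR by simp
  then have "?S \<noteq> {}" by blast
  moreover have "continuous_on ?S (\<lambda>x. norm (A x))"
  proof -
    \<comment> \<open>Continuity of \<open>A\<close> is what lets its norm be attained on the
      compact unit sphere of \<open>E\<close>.\<close>
    have "1-lipschitz_on ?S A"
      by (rule lipschitz_onI) (use A_le A_diff C.subspace_diff[OF E(1)] in \<open>auto simp: dist_norm simp flip: A_diff\<close>)
    then show ?thesis by (intro continuous_on_norm lipschitz_on_continuous_on)
  qed
  ultimately obtain w where w: "w \<in> ?S" and w_max: "\<And>x. x \<in> ?S \<Longrightarrow> norm (A x) \<le> norm (A w)"
    using continuous_attains_sup[OF E(3)] by meson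
  define l where "l = norm (A w)"
  have le: "norm (A x) \<le> l * norm x" if x: "x \<in> E" for x
  proof (cases "x = 0")
    case False
    have "(1 / norm x) *\<^sub>R x \<in> ?S" using x False A_scaleR by simp
    from w_max[OF this] show ?thesis using False x by (simp add: A_scaleR l_def field_simps)
  qed (simp add: A0)
  have "l > 0" using le[OF x0] Ax0 by (smt (verit) l_def mult_eq_0_iff norm_eq_zero zero_less_norm_iff norm_ge_zero)
  define E' where "E' = {x \<in> E. norm (A x) = l * norm x}"
  have E': "C.subspace E'" unfolding E'_def
    by (rule norm_attaining_set_subspace[OF E(1) A_add A_scale le])
  have E'E: "E' \<subseteq> E" by (auto simp: E'_def)
  have inv': "U g x \<in> E'" if "g \<in> carrier G" "x \<in> E'" for g x
    using that E(2) by (auto simp: E'_def invariantD A_U U_norm)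
  define D where "D x = (1 / complex_of_real l) *\<^sub>C A x" for x
  have D_norm: "norm (D x) = norm x" if "x \<in> E'" for x
    using that \<open>l > 0\<close> by (simp add: D_def E'_def norm_scaleC norm_divide)
  \<comment> \<open>\<open>A\<close> maps the complement of the range to the complement of the
    domain, so the new vectors \<open>x\<close> go to the range side and the rescaled images
    \<open>D x\<close> to the domain side. Both sums are orthogonal, which keeps the graph
    isometric.\<close>
  define \<Delta> where "\<Delta> = {(a + D x, b + x) | a b x. (a, b) \<in> \<Gamma> \<and> x \<in> E'}"
  have \<Delta>I: "(p, q) \<in> \<Delta>" if "p = a + D x" "q = b + x" "(a, b) \<in> \<Gamma>" "x \<in> E'" for p q a b x
    unfolding \<Delta>_def using that by blast
  have "isometric_graph \<Delta>"
    unfolding isometric_graph_def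
  proof (intro conjI allI impI)
    show "(0, 0) \<in> \<Delta>"
      by (rule \<Delta>I[OF _ _ isometric_graphD(1)[OF \<Gamma>] C.subspace_0[OF E']]) (simp_all add: D_def A0)
    fix p q assume "(p, q) \<in> \<Delta>"
    then obtain a b x where pq: "p = a + D x" "q = b + x" "(a, b) \<in> \<Gamma>" "x \<in> E'"
      unfolding \<Delta>_def by blast
    then have xE: "x \<in> E" using E'E by blast
    have "cinner a (D x) = 0" using A_orth[OF xE, of a] pq by (simp add: D_def cinner_scaleC_right Domain.intros)
    moreover have "cinner b x = 0" using E_orth[OF xE, of b] pq by blast
    ultimately have "(norm p)\<^sup>2 = (norm q)\<^sup>2"
      using D_norm[OF pq(4)] isometric_graphD(4)[OF \<Gamma> pq(3)] by (simp add: pq norm_add_sq_orthogonal)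
    then show "norm p = norm q" by (simp add: power2_eq_iff_nonneg)
    show "(t *\<^sub>C p, t *\<^sub>C q) \<in> \<Delta>" for t
      by (rule \<Delta>I[OF _ _ isometric_graphD(3)[OF \<Gamma> pq(3)] C.subspace_scale[OF E' pq(4)]])
         (simp_all add: pq D_def A_scale[OF xE] C.scale_right_distrib mult.commute)
    show "(U g p, U g q) \<in> \<Delta>" if "g \<in> carrier G" for g
      by (rule \<Delta>I[OF _ _ isometric_graphD(5)[OF \<Gamma> that pq(3)] inv'[OF that pq(4)]])
         (simp_all add: pq D_def A_U[OF that xE] U_add[OF that] U_scale[OF that])
    fix p' q' assume "(p', q') \<in> \<Delta>"
    then obtain a' b' x' where pq': "p' = a' + D x'" "q' = b' + x'" "(a', b') \<in> \<Gamma>" "x' \<in> E'"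
      unfolding \<Delta>_def by blast
    then have "x' \<in> E" using E'E by blast
    then have "D (x + x') = D x + D x'" using xE by (simp add: D_def A_add C.scale_right_distrib)
    then show "(p + p', q + q') \<in> \<Delta>"
      by (intro \<Delta>I[OF _ _ isometric_graphD(2)[OF \<Gamma> pq(3) pq'(3)] C.subspace_add[OF E' pq(4) pq'(4)]])
         (simp_all add: pq pq' add_ac)
  qed
  moreover have "(a, b) \<in> \<Delta>" if "(a, b) \<in> \<Gamma>" for a b
    by (rule \<Delta>I[OF _ _ that C.subspace_0[OF E']]) (simp_all add: D_def A0)
  then have "\<Gamma> \<subseteq> \<Delta>" by (rule subrelI)
  ultimately have "\<Delta> = \<Gamma>" using max by (simp add: maximal_graph_def)
  moreover have "w \<in> E'" using w by (auto simp: E'_def l_def)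
  then have "(D w, w) \<in> \<Delta>"
    by (intro \<Delta>I[OF _ _ isometric_graphD(1)[OF \<Gamma>]]) simp_all
  ultimately have "w \<in> Range \<Gamma>" by blast
  then have "cinner w w = 0" using E_orth w by blast
  then show False using w by simp
qed

text \<open>Orthogonality of \<open>\<Sum>k. c k *\<^sub>C S k b\<close> to \<open>P\<close> for all \<open>b \<in> B\<close> is a finite system of linear
  equations in the coefficients \<open>c\<close>, so it has a nontrivial solution.\<close>

lemma finite_multiplicity:
  assumes "finite P"
    and E: "C.subspace E" "invariant E" "finite B" "B \<subseteq> E" "E \<subseteq> C.span B" and x: "x \<in> E" "x \<noteq> 0"
    and add: "\<And>k x y. x \<in> E \<Longrightarrow> y \<in> E \<Longrightarrow> S k (x + y) = S k x + S k y"
    and scale: "\<And>k t x. x \<in> E \<Longrightarrow> S k (t *\<^sub>C x) = t *\<^sub>C S k x"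
    and S_U: "\<And>k g x. g \<in> carrier G \<Longrightarrow> x \<in> E \<Longrightarrow> S k (U g x) = U g (S k x)"
    and iso: "\<And>(k::nat) x. x \<in> E \<Longrightarrow> norm (S k x) = norm x"
    and orth: "\<And>j k x y. j \<noteq> k \<Longrightarrow> x \<in> E \<Longrightarrow> y \<in> E \<Longrightarrow> cinner (S j x) (S k y) = 0"
    and gen: "\<And>k x l. x \<in> E \<Longrightarrow> \<forall>p\<in>P. \<forall>g\<in>carrier G. cinner (U g p) l = 0 \<Longrightarrow> cinner l (S k x) = 0"
  shows False
proof -
  obtain K c where K: "finite K" "\<exists>k\<in>K. c k \<noteq> 0"
    and c: "\<And>p b. p \<in> P \<Longrightarrow> b \<in> B \<Longrightarrow> (\<Sum>k\<in>K. c k * cinner p (S k b)) = 0"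
    using exists_nontrivial_coefficients[of "P \<times> B" 0 "\<lambda>(p, b) k. cinner p (S k b)"] \<open>finite P\<close> E(3)
    by fastforce
  define R where "R x = (\<Sum>k\<in>K. c k *\<^sub>C S k x)" for x
  have zero: "cinner p (R x) = 0" if p: "p \<in> P" and x: "x \<in> E" for p x
  proof -
    have "C.subspace {x \<in> E. cinner p (R x) = 0}"
    proof (rule C.subspaceI)
      have "S k 0 = 0" for k using iso[OF C.subspace_0[OF E(1)], of k] by simp
      then show "0 \<in> {x \<in> E. cinner p (R x) = 0}" using E(1) by (simp add: R_def C.subspace_0)
      show "x + y \<in> {x \<in> E. cinner p (R x) = 0}"
        if "x \<in> {x \<in> E. cinner p (R x) = 0}" "y \<in> {x \<in> E. cinner p (R x) = 0}" for x y
        using that E(1) by (simp add: R_def add C.subspace_add C.scale_right_distrib sum.distrib cinner_add_right)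
      show "t *\<^sub>C x \<in> {x \<in> E. cinner p (R x) = 0}" if "x \<in> {x \<in> E. cinner p (R x) = 0}" for t x
      proof -
        have "R (t *\<^sub>C x) = t *\<^sub>C R x"
          using that by (simp add: R_def scale C.scale_sum_right mult.commute)
        then show ?thesis using that E(1) by (simp add: C.subspace_scale cinner_scaleC_right)
      qed
    qed
    moreover have "B \<subseteq> {x \<in> E. cinner p (R x) = 0}"
      using E(4) c[OF p] by (auto simp: R_def cinner_sum_right cinner_scaleC_right)
    ultimately have "C.span B \<subseteq> {x \<in> E. cinner p (R x) = 0}" by (rule C.span_minimal[rotated])
    then show ?thesis using E(5) x by blast
  qed
  \<comment> \<open>\<open>R\<close> commutes with the representation, so orthogonality to
    \<open>P\<close> on all of \<open>E\<close> extends to the orbits of \<open>P\<close>. Then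
    \<open>gen\<close> makes \<open>R x\<close> orthogonal to every \<open>S k x\<close>, although
    \<open>R x\<close> has a nonzero component along one of them.\<close>
  have "cinner (U g p) (R x) = 0" if "p \<in> P" "g \<in> carrier G" for p g
  proof -
    have "U (inv g) (R x) = R (U (inv g) x)"
      using that x unfolding R_def
      by (simp add: linear_sum[OF bounded_linear.linear[OF bounded_linear_U]] U_scale S_U)
    then show ?thesis using zero[OF that(1)] that E(2) x by (simp add: cinner_U_left invariantD)
  qed
  then have "cinner (R x) (S k x) = 0" for k using gen[OF x(1)] by blast
  then have S_R: "cinner (S k x) (R x) = 0" for k by (simp add: cinner_eq_0_commute)
  obtain k where k: "k \<in> K" "c k \<noteq> 0" using K by blast
  have "cinner (S k x) (R x) = (\<Sum>j\<in>K. c j * cinner (S k x) (S j x))"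
    by (simp add: R_def cinner_sum_right cinner_scaleC_right)
  also have "\<dots> = (\<Sum>j\<in>K. if j = k then c k * cinner (S k x) (S k x) else 0)"
    using orth x by (intro sum.cong) auto
  also have "\<dots> = c k * cinner (S k x) (S k x)" using K k by simp
  finally have "S k x = 0" using k S_R by simp
  then show False using iso[OF x(1), of k] x by simp
qed

text \<open>The assumption \<open>diag\<close> says that the graph is the identity on the complement
  of the orbits of \<open>P\<close>. It is symmetric in both components, so the lemma applies
  equally to the converse graph, whose range is the domain.\<close>

lemma maximal_graph_total:
  assumes max: "maximal_graph \<Gamma>" and "finite P"
    and diag: "\<And>l. \<forall>p\<in>P. \<forall>g\<in>carrier G. cinner (U g p) l = 0 \<Longrightarrow> (l, l) \<in> \<Gamma>"
  shows "Range \<Gamma> = UNIV"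
proof (rule ccontr)
  have \<Gamma>: "isometric_graph \<Gamma>" using max by (simp add: maximal_graph_def)
  note N = isometric_graph_Range[OF \<Gamma>]
  have closed: "closed \<Gamma>" using max by (rule maximal_graph_closed)
  let ?Y = "{y. \<forall>n\<in>Range \<Gamma>. cinner n y = 0}"
  assume "Range \<Gamma> \<noteq> UNIV"
  then obtain z where z: "z \<notin> Range \<Gamma>" by blast
  obtain n where n: "n \<in> Range \<Gamma>" "z - n \<in> ?Y"
    using orthogonal_projection_exists[OF N(1) N(3)[OF closed], of z] by blast
  have "z - n \<noteq> 0" using z n by auto
  then obtain E B where E: "C.subspace E" "E \<subseteq> ?Y" "invariant E" "\<exists>x\<in>E. x \<noteq> 0"
    and B: "finite B" "B \<subseteq> E" "E \<subseteq> C.span B" and cE: "compact (E \<inter> sphere 0 1)"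
    by (rule exists_finite_invariant_subspace[OF subspace_orthogonal closed_orthogonal
        invariant_orthogonal[OF N(2)] n(2)])
  \<comment> \<open>\<open>S k\<close> is the \<open>k\<close>-th power of the partial map, made
    total by choice; it is meaningful on \<open>E\<close> once \<open>E\<close> lies in the domain
    of that power.\<close>
  define S where "S k x = (SOME y. (x, y) \<in> \<Gamma> ^^ k)" for k x
  have \<Gamma>k: "isometric_graph (\<Gamma> ^^ k)" for k using \<Gamma> by (rule isometric_graph_relpow)
  have S: "(x, S k x) \<in> \<Gamma> ^^ k" if "E \<subseteq> Domain (\<Gamma> ^^ k)" "x \<in> E" for k x
    using that someI_ex[of "\<lambda>y. (x, y) \<in> \<Gamma> ^^ k"] unfolding S_def by blast
  have S_eq: "S k x = y" if "E \<subseteq> Domain (\<Gamma> ^^ k)" "x \<in> E" "(x, y) \<in> \<Gamma> ^^ k" for k x y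
    using isometric_graph_unique[OF \<Gamma>k S[OF that(1,2)] that(3)] .
  have S_add: "S k (x + y) = S k x + S k y"
    if "E \<subseteq> Domain (\<Gamma> ^^ k)" "x \<in> E" "y \<in> E" for k x y
    using that by (intro S_eq isometric_graphD(2)[OF \<Gamma>k] S C.subspace_add[OF E(1)])
  have S_scale: "S k (t *\<^sub>C x) = t *\<^sub>C S k x" if "E \<subseteq> Domain (\<Gamma> ^^ k)" "x \<in> E" for k t x
    using that by (intro S_eq isometric_graphD(3)[OF \<Gamma>k] S C.subspace_scale[OF E(1)])
  have S_U: "S k (U g x) = U g (S k x)" if "E \<subseteq> Domain (\<Gamma> ^^ k)" "g \<in> carrier G" "x \<in> E" for k g x
    using that by (intro S_eq isometric_graphD(5)[OF \<Gamma>k] S invariantD[OF E(3)])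
  have S_norm: "norm (S k x) = norm x" if "E \<subseteq> Domain (\<Gamma> ^^ k)" "x \<in> E" for k x
    using isometric_graphD(4)[OF \<Gamma>k S[OF that]] by simp
  show False
  proof (cases "\<forall>k. E \<subseteq> Domain (\<Gamma> ^^ k)")
    case True
    \<comment> \<open>Stripping \<open>j\<close> applications from both sides leaves
      \<open>x\<close>, which is orthogonal to the range, and a vector \<open>u\<close> reached by
      at least one application, hence in the range.\<close>
    have less: "cinner (S j x) (S k y) = 0" if "j < k" and xy: "x \<in> E" "y \<in> E" for j k x y
    proof -
      obtain i where k: "k = Suc i + j" using \<open>j < k\<close> by (metis add.commute add_Suc_right less_iff_Suc_add)
      have "(y, S k y) \<in> \<Gamma> ^^ k" using S True xy by blast
      then have "(y, S k y) \<in> \<Gamma> ^^ Suc i O \<Gamma> ^^ j" by (simp only: k relpow_add)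
      then obtain u where u: "(y, u) \<in> \<Gamma> ^^ Suc i" "(u, S k y) \<in> \<Gamma> ^^ j" by blast
      then have "u \<in> Range \<Gamma>" by auto
      then have "cinner x u = 0" using E(2) xy cinner_eq_0_commute by blast
      then show ?thesis using isometric_graph_cinner[OF \<Gamma>k S[of j x] u(2)] True xy by simp
    qed
    then have orth: "cinner (S j x) (S k y) = 0" if "j \<noteq> k" "x \<in> E" "y \<in> E" for j k x y
      using that by (metis cinner_eq_0_commute nat_neq_iff)
    \<comment> \<open>All powers fix \<open>l\<close>, so the inner product equals
      \<open>cinner l x\<close>; this vanishes because \<open>l\<close> is in the range.\<close>
    have gen: "cinner l (S k x) = 0"
      if x: "x \<in> E" and l: "\<forall>p\<in>P. \<forall>g\<in>carrier G. cinner (U g p) l = 0" for k x l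
    proof -
      have ll: "(l, l) \<in> \<Gamma>" using diag[OF l] .
      then have "(l, l) \<in> \<Gamma> ^^ k" by (induction k) auto
      from isometric_graph_cinner[OF \<Gamma>k this S[of k x]]
      have "cinner l (S k x) = cinner l x" using True x by simp
      also have "\<dots> = 0" using ll E(2) x by blast
      finally show ?thesis .
    qed
    note D = True[rule_format]
    from E(4) obtain x where x: "x \<in> E" "x \<noteq> 0" by blast
    show False
      by (rule finite_multiplicity[OF \<open>finite P\<close> E(1,3) B x S_add[OF D] S_scale[OF D] S_U[OF D]
            S_norm[OF D] orth gen])
  next
    case False
    \<comment> \<open>The power 0 is the identity and defined everywhere, so the first failing
      exponent is a successor \<open>Suc j\<close>, and the power \<open>j\<close> is still defined
      on \<open>E\<close>.\<close>
    define k where "k = (LEAST k. \<not> E \<subseteq> Domain (\<Gamma> ^^ k))"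
    have k: "\<not> E \<subseteq> Domain (\<Gamma> ^^ k)" unfolding k_def using False by (metis LeastI_ex)
    then obtain j where j: "k = Suc j" by (cases k) auto
    have "E \<subseteq> Domain (\<Gamma> ^^ j)" using not_less_Least[of j "\<lambda>k. \<not> E \<subseteq> Domain (\<Gamma> ^^ k)"] j by (simp add: k_def)
    note Sj = S[OF this] S_add[OF this] S_scale[OF this] S_U[OF this] S_norm[OF this]
    have M: "C.subspace (Domain \<Gamma>)" "invariant (Domain \<Gamma>)" "closed (Domain \<Gamma>)"
      using isometric_graph_Range[OF isometric_graph_converse[OF \<Gamma>]]
        maximal_graph_closed[OF maximal_graph_converse[OF max]] by (simp_all add: Range_converse)
    \<comment> \<open>\<open>p\<close> is the orthogonal projection onto the domain. Uniqueness of
      the projection (\<open>p_eq\<close>) yields its linearity and equivariance.\<close>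
    obtain p where pM: "\<And>x. p x \<in> Domain \<Gamma>" and p: "\<And>x m. m \<in> Domain \<Gamma> \<Longrightarrow> cinner m (x - p x) = 0"
      using orthogonal_projection_exists[OF M(1,3)] by metis
    have p_eq: "p x = q" if "q \<in> Domain \<Gamma>" "\<And>m. m \<in> Domain \<Gamma> \<Longrightarrow> cinner m (x - q) = 0" for x q
    proof -
      have "p x - q \<in> Domain \<Gamma>" using M(1) pM that(1) by (simp add: C.subspace_diff)
      then have "cinner (p x - q) ((x - q) - (x - p x)) = 0"
        unfolding cinner_diff_right[of _ "x - q"] using that(2) p by simp
      then show ?thesis by simp
    qed
    have p_add: "p (x + y) = p x + p y" for x y
    proof (rule p_eq)
      show "p x + p y \<in> Domain \<Gamma>" using M(1) pM by (simp add: C.subspace_add)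
      show "cinner m (x + y - (p x + p y)) = 0" if "m \<in> Domain \<Gamma>" for m
        unfolding add_diff_add cinner_add_right using p[OF that] by simp
    qed
    have p_scale: "p (t *\<^sub>C x) = t *\<^sub>C p x" for t x
    proof (rule p_eq)
      show "t *\<^sub>C p x \<in> Domain \<Gamma>" using M(1) pM by (simp add: C.subspace_scale)
      show "cinner m (t *\<^sub>C x - t *\<^sub>C p x) = 0" if "m \<in> Domain \<Gamma>" for m
        unfolding C.scale_right_diff_distrib[symmetric] cinner_scaleC_right using p[OF that] by simp
    qed
    have p_U: "p (U g x) = U g (p x)" if g: "g \<in> carrier G" for g x
    proof (rule p_eq)
      show "U g (p x) \<in> Domain \<Gamma>" using M(2) pM g by (simp add: invariantD)
      show "cinner m (U g x - U g (p x)) = 0" if "m \<in> Domain \<Gamma>" for m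
      proof -
        have "U g x - U g (p x) = U g (x - p x)"
          using g by (simp add: linear_diff[OF bounded_linear.linear[OF bounded_linear_U]])
        moreover have "U (inv g) m \<in> Domain \<Gamma>" using M(2) that g by (simp add: invariantD)
        ultimately show ?thesis using p cinner_U_left[of "inv g" m "x - p x"] g by simp
      qed
    qed
    \<comment> \<open>\<open>A\<close> measures how far \<open>S j x\<close> is from the domain. By
      maximality it vanishes, so one more application is possible, against the choice of
      \<open>k\<close>.\<close>
    define A where "A x = S j x - p (S j x)" for x
    have A_zero: "A x = 0" if x: "x \<in> E" for x
    proof (rule maximal_graph_intertwiner_zero[OF max E(1) E(3) cE _ _ _ _ _ _ x])
      show "cinner b x = 0" if "x \<in> E" "b \<in> Range \<Gamma>" for x b using that E(2) by blast
      show "A (x + y) = A x + A y" if "x \<in> E" "y \<in> E" for x y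
        using that by (simp add: A_def Sj p_add)
      show "A (t *\<^sub>C x) = t *\<^sub>C A x" if "x \<in> E" for t x
        using that by (simp add: A_def Sj p_scale C.scale_right_diff_distrib)
      show "A (U g x) = U g (A x)" if "g \<in> carrier G" "x \<in> E" for g x
        using that by (simp add: A_def Sj p_U linear_diff[OF bounded_linear.linear[OF bounded_linear_U]])
      show "norm (A x) \<le> norm x" if "x \<in> E" for x
      proof -
        have "(norm (p (S j x) + A x))\<^sup>2 = (norm (p (S j x)))\<^sup>2 + (norm (A x))\<^sup>2"
          unfolding A_def by (rule norm_add_sq_orthogonal[OF p[OF pM]])
        then have "(norm (A x))\<^sup>2 \<le> (norm x)\<^sup>2" using Sj(5)[OF that] by (simp add: A_def)
        then show ?thesis by (rule power2_le_imp_le) simp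
      qed
      show "cinner a (A x) = 0" if "x \<in> E" "a \<in> Domain \<Gamma>" for x a
        unfolding A_def using p[OF that(2)] .
    qed
    have "E \<subseteq> Domain (\<Gamma> ^^ k)"
    proof
      fix x assume x: "x \<in> E"
      have "S j x \<in> Domain \<Gamma>" using A_zero[OF x] pM[of "S j x"] by (simp add: A_def)
      then obtain b where "(S j x, b) \<in> \<Gamma>" by blast
      then have "(x, b) \<in> \<Gamma> ^^ k" using relcompI[OF Sj(1)[OF x]] by (simp add: j)
      then show "x \<in> Domain (\<Gamma> ^^ k)" by (rule DomainI)
    qed
    with k show False by blast
  qed
qed

section \<open>From total graphs to invariant unitaries\<close>

lemma invariant_unitary_of_graph:
  assumes \<Gamma>: "isometric_graph \<Gamma>" and dom: "Domain \<Gamma> = UNIV" and ran: "Range \<Gamma> = UNIV"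
  obtains W where "unitary W" "G_invariant G U W" "\<And>a b. (a, b) \<in> \<Gamma> \<Longrightarrow> W a = b"
proof -
  define W where "W a = (THE b. (a, b) \<in> \<Gamma>)" for a
  have W_eq: "W a = b" if "(a, b) \<in> \<Gamma>" for a b
    unfolding W_def using that isometric_graph_unique[OF \<Gamma>] by blast
  have W: "(a, W a) \<in> \<Gamma>" for a
    using dom W_eq by (metis DomainE UNIV_I)
  have "Vector_Spaces.linear scaleC scaleC W"
    unfolding Vector_Spaces.linear_iff
    using C.vector_space_axioms W_eq isometric_graphD(2,3)[OF \<Gamma>] W by blast
  moreover have "\<exists>a. b = W a" for b
  proof -
    have "b \<in> Range \<Gamma>" using ran by simp
    then show ?thesis using W_eq by blast
  qed
  then have "surj W" by (simp add: surj_def)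
  moreover have "cinner (W x) (W y) = cinner x y" for x y
    using isometric_graph_cinner[OF \<Gamma> W W] by simp
  ultimately have "unitary W" by (simp add: unitary_def)
  moreover have "G_invariant G U W"
    using W_eq[OF isometric_graphD(5)[OF \<Gamma> _ W]] by (simp add: G_invariant_def commutator_def)
  ultimately show thesis using that W_eq by blast
qed

text \<open>From left to right the same unitary serves. Conversely, \<open>V\<close> restricted to a
  subspace \<open>M\<close> containing \<open>\<psi>\<close>, joined with the identity on
  \<open>L\<close>, is an isometric graph; a maximal extension is total on both sides.\<close>

lemma invariant_unitary_iff:
  "(\<exists>V. unitary V \<and> G_invariant G U V \<and> V \<psi> = \<phi>)
     \<longleftrightarrow> (\<exists>V. unitary V \<and> (\<forall>g\<in>carrier G. V (U g \<psi>) = U g \<phi>))"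
proof
  assume "\<exists>V. unitary V \<and> G_invariant G U V \<and> V \<psi> = \<phi>"
  then obtain V where V: "unitary V" "G_invariant G U V" "V \<psi> = \<phi>" by blast
  have "V (U g x) = U g (V x)" if "g \<in> carrier G" for g x
    using V(2) that unfolding G_invariant_def commutator_def by (metis eq_iff_diff_eq_0)
  with V show "\<exists>V. unitary V \<and> (\<forall>g\<in>carrier G. V (U g \<psi>) = U g \<phi>)" by metis
next
  assume "\<exists>V. unitary V \<and> (\<forall>g\<in>carrier G. V (U g \<psi>) = U g \<phi>)"
  then obtain V where V: "unitary V" and VU: "\<And>g. g \<in> carrier G \<Longrightarrow> V (U g \<psi>) = U g \<phi>" by blast
  have V_lin: "V (x + y) = V x + V y" "V (t *\<^sub>C x) = t *\<^sub>C V x" for t x y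
    using V by (simp_all add: unitary_def Vector_Spaces.linear_iff)
  have V_norm: "norm (V x) = norm x" for x
    using V norm_sq_cinner[of x] norm_sq_cinner[of "V x"]
    by (metis norm_ge_zero power2_eq_imp_eq unitary_def)
  have V0: "V 0 = 0" using V_norm[of 0] by simp
  have V\<psi>: "V \<psi> = \<phi>" using VU[of \<one>] by (simp add: U_one)
  \<comment> \<open>\<open>L\<close> is the orthogonal complement of the subspace generated by both
    orbits.\<close>
  define L where "L = {l. \<forall>p\<in>{\<psi>, \<phi>}. \<forall>g\<in>carrier G. cinner (U g p) l = 0}"
  have L: "C.subspace L" by (auto simp: L_def C.subspace_def cinner_add_right cinner_scaleC_right)
  have invL: "U g l \<in> L" if "g \<in> carrier G" "l \<in> L" for g l
  proof -
    have "cinner (U h p) (U g l) = 0" if h: "h \<in> carrier G" and p: "p \<in> {\<psi>, \<phi>}" for h p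
    proof -
      have "inv g \<otimes> h \<in> carrier G" using h \<open>g \<in> carrier G\<close> by simp
      then have "cinner (U (inv g \<otimes> h) p) l = 0" using \<open>l \<in> L\<close> p unfolding L_def by blast
      then show ?thesis using h \<open>g \<in> carrier G\<close> cinner_U_left[of "inv g" "U h p" l] by (simp add: U_mult)
    qed
    then show ?thesis by (auto simp: L_def)
  qed
  \<comment> \<open>Instead of the span of the orbit of \<open>\<psi>\<close>, \<open>M\<close>
    collects all vectors on which \<open>V\<close> intertwines and which, like their images, are
    orthogonal to \<open>L\<close>. Being given by linear, invariant conditions, it is directly an
    invariant subspace.\<close>
  define M where "M = {m. (\<forall>g\<in>carrier G. V (U g m) = U g (V m)) \<and> (\<forall>l\<in>L. cinner l m = 0 \<and> cinner l (V m) = 0)}"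
  have M: "C.subspace M"
    by (auto simp: M_def C.subspace_def V_lin U_add U_scale U_zero cinner_add_right cinner_scaleC_right V0)
  have invM: "U g m \<in> M \<and> V (U g m) = U g (V m)" if g: "g \<in> carrier G" and m: "m \<in> M" for g m
  proof -
    have "cinner l (U g x) = 0" if "l \<in> L" "\<forall>l\<in>L. cinner l x = 0" for l x
      using that g cinner_U_left[of "inv g" l x] invL[of "inv g" l] by simp
    moreover have "V (U h (U g m)) = U h (V (U g m))" if "h \<in> carrier G" for h
      using m g that by (simp add: M_def U_mult)
    ultimately show ?thesis using m g by (simp add: M_def)
  qed
  have \<psi>M: "\<psi> \<in> M"
  proof -
    have "cinner l \<psi> = 0 \<and> cinner l \<phi> = 0" if "l \<in> L" for l
    proof -
      have "cinner (U \<one> \<psi>) l = 0" "cinner (U \<one> \<phi>) l = 0" using that by (auto simp: L_def)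
      then show ?thesis by (simp add: U_one cinner_eq_0_commute)
    qed
    then show ?thesis using VU by (simp add: M_def V\<psi>)
  qed
  define \<Gamma> where "\<Gamma> = {(m + l, V m + l) | m l. m \<in> M \<and> l \<in> L}"
  have \<Gamma>I: "(a, b) \<in> \<Gamma>" if "a = m + l" "b = V m + l" "m \<in> M" "l \<in> L" for a b m l
    using that by (auto simp: \<Gamma>_def)
  have "isometric_graph \<Gamma>"
    unfolding isometric_graph_def
  proof (intro conjI allI impI)
    show "(0, 0) \<in> \<Gamma>" using V0 C.subspace_0[OF M] C.subspace_0[OF L] by (intro \<Gamma>I[of _ 0 0]) simp_all
    fix a b assume "(a, b) \<in> \<Gamma>"
    then obtain m l where ab: "a = m + l" "b = V m + l" "m \<in> M" "l \<in> L" by (auto simp: \<Gamma>_def)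
    have "cinner m l = 0" "cinner (V m) l = 0" using ab by (auto simp: M_def cinner_eq_0_commute)
    then have "(norm a)\<^sup>2 = (norm b)\<^sup>2" by (simp add: ab norm_add_sq_orthogonal V_norm)
    then show "norm a = norm b" by (simp add: power2_eq_iff_nonneg)
    show "(t *\<^sub>C a, t *\<^sub>C b) \<in> \<Gamma>" for t
      using ab C.subspace_scale[OF M] C.subspace_scale[OF L]
      by (intro \<Gamma>I[of _ "t *\<^sub>C m" "t *\<^sub>C l"]) (simp_all add: V_lin C.scale_right_distrib)
    show "(U g a, U g b) \<in> \<Gamma>" if "g \<in> carrier G" for g
      using ab invM[OF that ab(3)] invL[OF that ab(4)] that by (intro \<Gamma>I[of _ "U g m" "U g l"]) (simp_all add: U_add)
    fix c d assume "(c, d) \<in> \<Gamma>"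
    then obtain m' l' where cd: "c = m' + l'" "d = V m' + l'" "m' \<in> M" "l' \<in> L" by (auto simp: \<Gamma>_def)
    then show "(a + c, b + d) \<in> \<Gamma>" using ab C.subspace_add[OF M] C.subspace_add[OF L]
      by (intro \<Gamma>I[of _ "m + m'" "l + l'"]) (simp_all add: V_lin algebra_simps)
  qed
  then obtain \<Delta> where max: "maximal_graph \<Delta>" and sub: "\<Gamma> \<subseteq> \<Delta>" by (rule exists_maximal_graph)
  have diag: "(l, l) \<in> \<Delta>" if "\<forall>p\<in>{\<psi>, \<phi>}. \<forall>g\<in>carrier G. cinner (U g p) l = 0" for l
  proof -
    have "(l, l) \<in> \<Gamma>" using V0 that C.subspace_0[OF M] by (intro \<Gamma>I[of _ 0 l]) (simp_all add: L_def)
    then show ?thesis using sub by blast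
  qed
  have fin: "finite {\<psi>, \<phi>}" by simp
  have "Range \<Delta> = UNIV" by (rule maximal_graph_total[OF max fin diag])
  moreover have "Range (\<Delta>\<inverse>) = UNIV"
    by (rule maximal_graph_total[OF maximal_graph_converse[OF max] fin]) (use diag in blast)
  ultimately obtain W where "unitary W" "G_invariant G U W" and W: "\<And>a b. (a, b) \<in> \<Delta> \<Longrightarrow> W a = b"
    using invariant_unitary_of_graph[of \<Delta>] max by (auto simp: maximal_graph_def Range_converse)
  moreover have "(\<psi>, \<phi>) \<in> \<Gamma>" using \<psi>M C.subspace_0[OF L] V\<psi> by (intro \<Gamma>I[of _ \<psi> 0]) simp_all
  then have "W \<psi> = \<phi>" using W sub by blast
  ultimately show "\<exists>V. unitary V \<and> G_invariant G U V \<and> V \<psi> = \<phi>" by blast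
qed

end

theorem lemma2:
  fixes G :: "('g, 'm) monoid_scheme"
    and T :: "'g topology"
    and A :: "('g, 'e::euclidean_space) chart set"
    and U :: "'g \<Rightarrow> 'h::chilbert_space \<Rightarrow> 'h"
    and \<psi> \<phi> :: 'h
  assumes "finite_discrete_group G T \<or> compact_lie_group G T A"
    and "unitary_rep G T U"
    and "norm \<psi> = 1" and "norm \<phi> = 1"
  shows "(\<exists>V. unitary V \<and> G_invariant G U V \<and> V \<psi> = \<phi>)
     \<longleftrightarrow> (\<exists>V. unitary V \<and> (\<forall>g\<in>carrier G. V (U g \<psi>) = U g \<phi>))"
proof -
  have "compact_unitary_rep G T U"
    using assms(1,2)
    by (auto simp: compact_unitary_rep_def finite_discrete_group_def compact_lie_group_def
        compact_space_discrete_topology)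
  then show ?thesis by (rule compact_unitary_rep.invariant_unitary_iff)
qed

end
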